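(* Let $\widetilde\Omega\subset\mathbb{C}$ be a domain enclosed by a smooth Jordan curve, containing $0$, with interior conformal mapping $\Phi[\widetilde\Omega](z)=b_1z+b_2z^2+b_3z^3+\cdots$, $b_1>0$, and let $\Omega=\left\{\frac1z:z\in\mathbb{C}\setminus\overline{\widetilde\Omega}\right\}\cup\{0\}$, with area $|\Omega|$. Then, for each choice of the sign $\pm$, $$\frac1{b_1^2}\pm\frac1{b_1^3}\operatorname{Re}\left(\frac{b_2^2}{b_1}-b_3\right)\ge\frac{|\Omega|}{2\pi}.$$ In particular, if $|\Omega|=1$, then $\frac1{b_1^2}\pm\frac1{b_1^3}\operatorname{Re}\left(\frac{b_2^2}{b_1}-b_3\right)\ge\frac1{2\pi}$. Further, suppose that $\widetilde V$ is another domain enclosed by a smooth Jordan curve satisfying $\widetilde\Omega\subseteq\widetilde V$, with interior conformal mapping $\Phi[\widetilde V](z)=c_1z+c_2z^2+c_3z^3+\cdots$, $c_1>0$. Then, for each choice of the sign $\pm$ (the same on both sides), $$\frac1{b_1^2}\pm\frac1{b_1^3}\operatorname{Re}\left(\frac{b_2^2}{b_1}-b_3\right)\ge\frac1{c_1^2}\pm\frac1{c_1^3}\operatorname{Re}\left(\frac{c_2^2}{c_1}-c_3\right).$$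
   Context: For a domain $\widetilde\Omega\subset\mathbb{C}$ enclosed by a Jordan curve and containing $0$, its interior conformal mapping $\Phi[\widetilde\Omega]$ is the unique conformal (bijective holomorphic) map from the open unit disk onto $\widetilde\Omega$ with $\Phi[\widetilde\Omega](0)=0$ and $\Phi[\widetilde\Omega]'(0)>0$; its Taylor coefficients are complex numbers, the first one being positive. *)

theory Defs
  imports "HOL-Complex_Analysis.Complex_Analysis"
begin

text \<open>
  \<open>D\<close> is the bounded component of the complement of a smooth Jordan curve. Smoothness is that of a
  closed curve, i.e. also across the base point, hence the parametrization is a 1-periodic function
  on all of \<open>\<real>\<close>; it is continuously differentiable with nowhere vanishing derivative.
\<close>

definition enclosed_by_smooth_Jordan_curve :: "complex set \<Rightarrow> bool" where
  "enclosed_by_smooth_Jordan_curve D \<longleftrightarrow>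
     (\<exists>g :: real \<Rightarrow> complex.
        simple_path g \<and> pathfinish g = pathstart g \<and>
        (\<forall>t. g (t + 1) = g t) \<and>
        g C1_differentiable_on UNIV \<and> (\<forall>t. vector_derivative g (at t) \<noteq> 0) \<and>
        D = inside (path_image g))"

definition interior_conformal_map :: "complex set \<Rightarrow> (complex \<Rightarrow> complex) \<Rightarrow> bool" where
  "interior_conformal_map D \<Phi> \<longleftrightarrow>
     \<Phi> holomorphic_on ball 0 1 \<and> bij_betw \<Phi> (ball 0 1) D \<and>
     \<Phi> 0 = 0 \<and> deriv \<Phi> 0 \<in> \<real> \<and> Re (deriv \<Phi> 0) > 0"

definition inverted_exterior :: "complex set \<Rightarrow> complex set" where
  "inverted_exterior D = {1 / z | z. z \<notin> closure D} \<union> {0}"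

end

theory Submission
  imports Defs
begin

text \<open>
  Write \<open>1 / \<Phi> z = \<gamma> / z + g z\<close> with \<open>g\<close> holomorphic in the disc; then \<open>\<gamma> = 1 / b\<^sub>1\<close> and
  \<open>a = g' 0 = (b\<^sub>2\<^sup>2 / b\<^sub>1 - b\<^sub>3) / b\<^sub>1\<^sup>2\<close>. Gronwall's area theorem gives
  \<open>|\<Omega>| \<le> \<pi> (\<gamma>\<^sup>2 - |a|\<^sup>2)\<close>, and the first claim becomes \<open>(\<gamma> \<plusminus> Re a)\<^sup>2 \<ge> 0\<close>.

  For the monotonicity, factor \<open>\<Phi> = \<Psi> \<circ> \<omega>\<close>. Since \<open>1 / u \<plusminus> u\<close> is injective in the punctured disc,
  \<open>1 / \<omega> \<plusminus> \<omega>\<close> is univalent, and the area theorem bounds its linear coefficient by the residue of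
  its pole. This is the claim, as the functional is additive along the factorization.

  The area theorem is proved without Green's formula. The omitted set and the image of
  the annulus \<open>\<rho> < |z| < r\<close> are disjoint subsets of the inside of the image of \<open>|z| = \<rho>\<close>, which lies in
  an ellipse of area \<open>\<pi> |\<gamma>|\<^sup>2 / \<rho>\<^sup>2 + o(1)\<close> as \<open>\<rho> \<rightarrow> 0\<close>. The area of the image of the annulus is
  computed in logarithmic coordinates, where orthogonality on circles shows that dropping all but
  the two leading coefficients can only decrease it.
\<close>

section \<open>Area of holomorphic images\<close>

text \<open>
  The change of variables theorem of the library is restricted to the types \<open>real^'n\<close>, hence the
  transport between \<open>real^2\<close>, \<open>real \<times> real\<close> and \<open>complex\<close>.
\<close>

lemma distr_lborel_Basis_bij:
  fixes f :: "'a::euclidean_space \<Rightarrow> 'b::euclidean_space"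
  assumes lin: "linear f" and bij: "bij_betw f Basis Basis"
  shows "distr lborel borel f = lborel"
proof (rule lborel_eqI[symmetric])
  have f_Basis: "f b \<in> Basis" if "b \<in> Basis" for b
    using bij that by (auto simp: bij_betw_def)
  have inner: "f x \<bullet> f b = x \<bullet> b" if b: "b \<in> Basis" for x b
  proof -
    have "f x = f (\<Sum>c\<in>Basis. (x \<bullet> c) *\<^sub>R c)"
      by (simp add: euclidean_representation)
    also have "\<dots> = (\<Sum>c\<in>Basis. (x \<bullet> c) *\<^sub>R f c)"
      by (simp add: linear_sum[OF lin] linear_cmul[OF lin])
    finally have "f x \<bullet> f b = (\<Sum>c\<in>Basis. (x \<bullet> c) * (f c \<bullet> f b))"
      by (simp add: inner_sum_left)
    also have "\<dots> = (\<Sum>c\<in>Basis. if c = b then x \<bullet> b else 0)"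
      using bij b by (intro sum.cong) (auto simp: inner_Basis f_Basis bij_betw_def inj_on_eq_iff)
    finally show ?thesis using b by simp
  qed
  have meas: "f \<in> borel_measurable borel"
    using lin by (simp add: borel_measurable_continuous_onI linear_continuous_on linear_linear)
  fix l u :: 'b
  assume le: "\<And>b. b \<in> Basis \<Longrightarrow> l \<bullet> b \<le> u \<bullet> b"
  \<comment> \<open>Corners of the preimage box: the coordinate along \<open>c\<close> is that of
    \<open>l\<close> or \<open>u\<close> along \<open>f c\<close>. Since \<open>f\<close> only
    relabels coordinates, side lengths are permuted and volumes of boxes agree, which determines the
    measure.\<close>
  define l' u' where "l' = (\<Sum>c\<in>Basis. (l \<bullet> f c) *\<^sub>R c)" and "u' = (\<Sum>c\<in>Basis. (u \<bullet> f c) *\<^sub>R c)"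
  have lu: "l' \<bullet> b = l \<bullet> f b" "u' \<bullet> b = u \<bullet> f b" if "b \<in> Basis" for b
    using that by (simp_all add: l'_def u'_def)
  have "f -` box l u = box l' u'"
  proof -
    have "x \<in> f -` box l u \<longleftrightarrow> (\<forall>b\<in>f ` Basis. l \<bullet> b < f x \<bullet> b \<and> f x \<bullet> b < u \<bullet> b)" for x
      using bij by (simp add: mem_box bij_betw_def)
    then show ?thesis by (auto simp: mem_box lu inner)
  qed
  then have "emeasure (distr lborel borel f) (box l u) = emeasure lborel (box l' u')"
    using meas by (simp add: emeasure_distr)
  also have "\<dots> = (\<Prod>b\<in>Basis. (u' - l') \<bullet> b)"
    by (rule emeasure_lborel_box) (simp add: lu le f_Basis)
  also have "(\<Prod>b\<in>Basis. (u' - l') \<bullet> b) = (\<Prod>b\<in>Basis. (u - l) \<bullet> f b)"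
    by (intro prod.cong) (auto simp: lu inner_diff_left)
  also have "\<dots> = (\<Prod>b\<in>Basis. (u - l) \<bullet> b)"
    by (rule prod.reindex_bij_betw[OF bij])
  finally show "emeasure (distr lborel borel f) (box l u) = (\<Prod>b\<in>Basis. (u - l) \<bullet> b)" .
qed simp

definition complex_of_vec :: "real^2 \<Rightarrow> complex" where
  "complex_of_vec v = Complex (v $ 1) (v $ 2)"

definition vec_of_complex :: "complex \<Rightarrow> real^2" where
  "vec_of_complex z = vector [Re z, Im z]"

lemma complex_of_vec_inverse [simp]: "vec_of_complex (complex_of_vec v) = v"
  by (simp add: vec_of_complex_def complex_of_vec_def vec_eq_iff forall_2)

lemma vec_of_complex_inverse [simp]: "complex_of_vec (vec_of_complex z) = z"
  by (simp add: vec_of_complex_def complex_of_vec_def)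

lemma linear_complex_of_vec: "linear complex_of_vec"
  by (rule linearI) (simp_all add: complex_of_vec_def complex_eq_iff)

lemma linear_vec_of_complex: "linear vec_of_complex"
  by (rule linearI) (simp_all add: vec_of_complex_def vec_eq_iff forall_2)

lemma distr_lborel_complex_of_vec: "distr lborel borel complex_of_vec = lborel"
proof (rule distr_lborel_Basis_bij[OF linear_complex_of_vec])
  have B: "(Basis :: (real^2) set) = {axis 1 1, axis 2 1}"
    by (auto simp: Basis_vec_def UNIV_2)
  have "complex_of_vec (axis 1 1) = 1" "complex_of_vec (axis 2 1) = \<i>"
    by (simp_all add: complex_of_vec_def axis_def complex_eq_iff)
  then show "bij_betw complex_of_vec Basis Basis"
    unfolding B Basis_complex_def by (auto simp: bij_betw_def)
qed

lemma distr_lborel_Complex: "distr lborel borel (\<lambda>(x, y). Complex x y) = lborel"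
proof (rule distr_lborel_Basis_bij)
  show "linear (\<lambda>(x, y). Complex x y)"
    by (rule linearI) (auto simp: complex_eq_iff)
  show "bij_betw (\<lambda>(x, y). Complex x y) Basis Basis"
    by (auto simp: Basis_prod_def Basis_complex_def bij_betw_def complex_eq_iff)
qed

lemma complex_of_vec_borel_measurable [measurable]: "complex_of_vec \<in> borel_measurable borel"
  using linear_complex_of_vec
  by (simp add: borel_measurable_continuous_onI linear_continuous_on linear_linear)

lemma measure_vec_of_complex_image:
  assumes "B \<in> sets borel"
  shows "measure lebesgue (vec_of_complex ` B) = measure lebesgue B"
    and "vec_of_complex ` B \<in> sets borel"
proof -
  have eq: "vec_of_complex ` B = complex_of_vec -` B"
    by (auto simp: image_iff) (metis complex_of_vec_inverse)
  show sets: "vec_of_complex ` B \<in> sets borel"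
    using measurable_sets[OF complex_of_vec_borel_measurable assms] by (simp add: eq)
  have "measure lebesgue B = measure (distr lborel borel complex_of_vec) B"
    using assms by (simp add: distr_lborel_complex_of_vec)
  also have "\<dots> = measure lborel (complex_of_vec -` B)"
    using assms by (subst measure_distr) auto
  finally show "measure lebesgue (vec_of_complex ` B) = measure lebesgue B"
    using sets by (simp add: eq)
qed

text \<open>The columns of the real matrix of \<open>L\<close> are the coordinates of
  \<open>L 1\<close> and \<open>L \<i>\<close>.\<close>

lemma det_matrix_conj_complex:
  assumes "linear L"
  shows "det (matrix (vec_of_complex \<circ> L \<circ> complex_of_vec)) = Re (L 1) * Im (L \<i>) - Im (L 1) * Re (L \<i>)"
proof -
  have "complex_of_vec (axis 1 1) = 1" "complex_of_vec (axis 2 1) = \<i>"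
    by (simp_all add: complex_of_vec_def axis_def complex_eq_iff)
  then show ?thesis
    by (simp add: det_2 matrix_def vec_of_complex_def)
qed

lemma measure_linear_image_complex:
  fixes L :: "complex \<Rightarrow> complex"
  assumes L: "linear L" and B: "compact B"
  shows "measure lebesgue (L ` B) = \<bar>Re (L 1) * Im (L \<i>) - Im (L 1) * Re (L \<i>)\<bar> * measure lebesgue B"
proof -
  let ?L = "vec_of_complex \<circ> L \<circ> complex_of_vec"
  have "compact (L ` B)"
    by (rule compact_continuous_image[OF linear_continuous_on[OF L[unfolded linear_conv_bounded_linear]] B])
  then have LB: "L ` B \<in> sets borel" by (rule borel_compact)
  have VB: "compact (vec_of_complex ` B)"
    by (rule compact_continuous_image[OF linear_continuous_on B])
       (use linear_vec_of_complex in \<open>simp add: linear_conv_bounded_linear\<close>)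
  have "measure lebesgue (L ` B) = measure lebesgue (vec_of_complex ` L ` B)"
    using measure_vec_of_complex_image[OF LB] by simp
  also have "vec_of_complex ` L ` B = ?L ` vec_of_complex ` B"
    by (auto simp: image_image)
  also have "measure lebesgue \<dots> = \<bar>det (matrix ?L)\<bar> * measure lebesgue (vec_of_complex ` B)"
    by (rule measure_linear_image)
       (auto intro!: linear_compose L linear_vec_of_complex linear_complex_of_vec lmeasurable_compact VB)
  also have "measure lebesgue (vec_of_complex ` B) = measure lebesgue B"
    using B measure_vec_of_complex_image borel_compact by blast
  finally show ?thesis by (simp only: det_matrix_conj_complex[OF L])
qed

section \<open>The area formula for injective holomorphic maps\<close>

text \<open>Multiplication by \<open>deriv H w\<close>, as a real linear map of the plane, has
  determinant \<open>|deriv H w|^2\<close>; this is the Jacobian in the change of variables.\<close>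

lemma measure_holomorphic_image:
  assumes S: "open S" and holo: "H holomorphic_on S" and inj: "inj_on H S"
    and int: "set_integrable lborel S (\<lambda>w. (norm (deriv H w))\<^sup>2)"
  shows "measure lebesgue (H ` S) = (LINT w:S|lborel. (norm (deriv H w))\<^sup>2)"
proof -
  let ?H = "vec_of_complex \<circ> H \<circ> complex_of_vec"
  let ?D = "\<lambda>v. vec_of_complex \<circ> (\<lambda>h. deriv H (complex_of_vec v) * h) \<circ> complex_of_vec"
  let ?f = "\<lambda>w. (norm (deriv H w))\<^sup>2"
  define S' where "S' = vec_of_complex ` S"
  have S'_eq: "S' = complex_of_vec -` S"
    by (auto simp: S'_def image_iff) (metis complex_of_vec_inverse)
  have S'[measurable]: "S' \<in> sets borel"
    unfolding S'_def by (rule measure_vec_of_complex_image) (use S in auto)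
  have HS: "open (H ` S)"
    using open_mapping_thm3[OF holo S inj] .
  have det: "\<bar>det (matrix (?D v))\<bar> = ?f (complex_of_vec v)" for v
  proof -
    have "linear (\<lambda>h. deriv H (complex_of_vec v) * h)"
      by (simp add: linear_conv_bounded_linear bounded_linear_mult_right)
    from det_matrix_conj_complex[OF this] show ?thesis
      by (simp add: cmod_power2 flip: power2_eq_square)
  qed
  have si: "set_integrable lborel S' (\<lambda>v. ?f (complex_of_vec v))"
  proof -
    have "set_integrable (distr lborel borel complex_of_vec) S ?f"
      using int by (simp add: distr_lborel_complex_of_vec)
    then have "integrable lborel (\<lambda>v. indicator S (complex_of_vec v) *\<^sub>R ?f (complex_of_vec v))"
      unfolding set_integrable_def by (intro integrable_distr[where T=complex_of_vec]) auto
    then show ?thesis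
      unfolding set_integrable_def S'_eq by (simp add: indicator_def)
  qed
  have "measure lebesgue (H ` S) = measure lebesgue (vec_of_complex ` H ` S)"
    using measure_vec_of_complex_image HS by simp
  also have "vec_of_complex ` H ` S = ?H ` S'"
    by (auto simp: S'_def image_image)
  also have "measure lebesgue \<dots> = integral S' (\<lambda>v. \<bar>det (matrix (?D v))\<bar>)"
  proof (rule measure_differentiable_image_eq)
    show "S' \<in> sets lebesgue" using S' by auto
    show "inj_on ?H S'"
      using inj by (auto simp: inj_on_def S'_def) (metis vec_of_complex_inverse)
    show "(\<lambda>v. \<bar>det (matrix (?D v))\<bar>) integrable_on S'"
      unfolding det using set_borel_integral_eq_integral(1)[OF si] .
    fix v assume "v \<in> S'"
    then have v: "complex_of_vec v \<in> S" by (simp add: S'_eq)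
    have 1: "(complex_of_vec has_derivative complex_of_vec) (at v within S')"
      using linear_complex_of_vec by (simp add: linear_imp_has_derivative)
    have 2: "(H has_derivative (\<lambda>h. deriv H (complex_of_vec v) * h)) (at (complex_of_vec v))"
      using holomorphic_derivI[OF holo S v] by (simp add: has_field_derivative_def)
    have 3: "(vec_of_complex has_derivative vec_of_complex) (at (H (complex_of_vec v)))"
      using linear_vec_of_complex by (simp add: linear_imp_has_derivative)
    show "(?H has_derivative ?D v) (at v within S')"
      using diff_chain_within[OF diff_chain_within[OF 1 has_derivative_at_withinI[OF 2]]
          has_derivative_at_withinI] 3 by (simp add: o_assoc)
  qed
  also have "\<dots> = (LINT v:S'|lborel. ?f (complex_of_vec v))"
    unfolding det using set_borel_integral_eq_integral(2)[OF si] by simp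
  also have "\<dots> = (LINT w|distr lborel borel complex_of_vec. indicator S w *\<^sub>R ?f w)"
    unfolding set_lebesgue_integral_def S'_eq
    using int unfolding set_integrable_def
    by (subst integral_distr) (auto simp: indicator_def)
  also have "\<dots> = (LINT w:S|lborel. ?f w)"
    by (simp add: distr_lborel_complex_of_vec set_lebesgue_integral_def)
  finally show ?thesis .
qed

text \<open>Brings the area into a form to which iterated integration applies. The closed box lies
  in \<open>U\<close>, so the integrand is continuous up to the boundary. Injectivity is asked on
  the open box because \<open>exp\<close> glues the horizontal sides of the rectangle used later;
  the boundary does not contribute to the integral.\<close>

lemma measure_holomorphic_image_box:
  assumes U: "open U" "H holomorphic_on U" and sub: "cbox (Complex a c) (Complex b d) \<subseteq> U"
    and inj: "inj_on H (box (Complex a c) (Complex b d))"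
  shows "measure lebesgue (H ` box (Complex a c) (Complex b d)) =
           integral (cbox (a, c) (b, d)) (\<lambda>(x, y). (norm (deriv H (Complex x y)))\<^sup>2)"
proof -
  let ?f = "\<lambda>w. (norm (deriv H w))\<^sup>2" and ?P = "\<lambda>(x, y). Complex x y"
  define B C where "B = box (Complex a c) (Complex b d)" and "C = box (a, c) (b, d)"
  have BC: "?P -` B = C"
    by (auto simp: B_def C_def mem_box Basis_complex_def Basis_prod_def)
  have B: "B \<subseteq> U" "open B" using sub box_subset_cbox by (force simp: B_def)+
  have P: "?P \<in> borel_measurable borel"
    by (intro borel_measurable_continuous_onI)
      (auto simp: case_prod_beta Complex_eq intro!: continuous_intros)
  have cont: "continuous_on (cbox (Complex a c) (Complex b d)) ?f"
    by (intro continuous_intros continuous_on_subset[OF holomorphic_on_imp_continuous_on sub]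
          holomorphic_deriv U)
  have int: "set_integrable lborel B ?f"
    unfolding B_def
    by (rule set_integrable_subset[OF borel_integrable_compact[OF compact_cbox cont, folded set_integrable_def, folded scaleR_conv_of_real]])
       (auto simp: box_subset_cbox)
  have eq: "indicator B (?P v) *\<^sub>R ?f (?P v) = indicator C v *\<^sub>R (\<lambda>(x, y). ?f (Complex x y)) v" for v
    by (cases v) (use BC in \<open>auto simp: indicator_def\<close>)
  have int2: "set_integrable lborel C (\<lambda>(x, y). ?f (Complex x y))"
  proof -
    have "integrable (distr lborel borel ?P) (\<lambda>w. indicator B w *\<^sub>R ?f w)"
      using int by (simp add: distr_lborel_Complex set_integrable_def)
    then have "integrable lborel (\<lambda>v. indicator B (?P v) *\<^sub>R ?f (?P v))"
      by (rule integrable_distr[rotated]) (use P in simp)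
    then show ?thesis unfolding set_integrable_def eq .
  qed
  have "measure lebesgue (H ` B) = (LINT w:B|lborel. ?f w)"
    by (rule measure_holomorphic_image)
       (use B U inj int in \<open>auto simp: B_def[symmetric] intro: holomorphic_on_subset\<close>)
  also have "\<dots> = (LINT w|distr lborel borel ?P. indicator B w *\<^sub>R ?f w)"
    by (simp add: distr_lborel_Complex set_lebesgue_integral_def)
  also have "\<dots> = (LINT v|lborel. indicator B (?P v) *\<^sub>R ?f (?P v))"
    using int P by (intro integral_distr) (auto simp: set_integrable_def)
  also have "\<dots> = (LINT v:C|lborel. (\<lambda>(x, y). ?f (Complex x y)) v)"
    unfolding eq set_lebesgue_integral_def ..
  also have "\<dots> = integral C (\<lambda>(x, y). ?f (Complex x y))"
    by (rule set_borel_integral_eq_integral(2)[OF int2])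
  also have "\<dots> = integral (cbox (a, c) (b, d)) (\<lambda>(x, y). ?f (Complex x y))"
    unfolding C_def by (rule integral_open_interval)
  finally show ?thesis by (simp add: B_def)
qed

text \<open>Cauchy's formula at the centre. It serves as the orthogonality relation: a holomorphic
  function vanishing at 0 integrates to 0 over circles.\<close>

lemma circle_mean_value:
  assumes F: "F holomorphic_on ball 0 R" and "0 < r" "r < R"
  shows "((\<lambda>t. F (of_real r * cis t)) has_integral 2 * of_real pi * F 0) {0..2*pi}"
proof -
  have "((\<lambda>u. F u / (u - 0)) has_contour_integral 2 * of_real pi * \<i> * F 0) (circlepath 0 r)"
    by (rule Cauchy_integral_circlepath_simple)
       (use assms in \<open>auto intro: holomorphic_on_subset\<close>)
  then have "((\<lambda>t. F (0 + of_real r * cis t) / (0 + of_real r * cis t - 0) * of_real r * \<i> * cis t)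
      has_integral 2 * of_real pi * \<i> * F 0) {0..2*pi}"
    unfolding circlepath_def by (subst (asm) has_contour_integral_part_circlepath_iff) auto
  then have "((\<lambda>t. F (of_real r * cis t) * \<i>) has_integral 2 * of_real pi * \<i> * F 0) {0..2*pi}"
    by (rule has_integral_eq_rhs[OF has_integral_eq, rotated 1])
       (use \<open>0 < r\<close> in \<open>auto simp: field_simps\<close>)
  from has_integral_mult_left[OF this, of "-\<i>"] show ?thesis
    by (simp add: algebra_simps)
qed

section \<open>The area theorem\<close>

lemma norm_diff_squared_complex: "(norm (a - b))\<^sup>2 = (norm a)\<^sup>2 + (norm b)\<^sup>2 - 2 * Re (cnj a * b)"
  by (simp add: cmod_power2) (simp add: power2_eq_square algebra_simps)

lemma Re_of_real_mult: "Re (of_real a * z) = a * Re z"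
  by simp

text \<open>Expand the square and replace \<open>|d|^2\<close> by its tangent at \<open>e\<close>,
  that is \<open>|d|^2 \<ge> |e|^2 + 2 Re (cnj e * (d - e))\<close>. For
  \<open>d = deriv g z\<close> and \<open>e = deriv g 0\<close>, the error on a circle of fixed
  \<open>norm z\<close> is then the real part of a holomorphic function vanishing at 0.\<close>

lemma norm_deriv_lower_bound:
  fixes \<gamma> d e z :: complex
  assumes "z \<noteq> 0"
  shows "(norm (z * d - \<gamma> / z))\<^sup>2 \<ge> (norm \<gamma>)\<^sup>2 / (norm z)\<^sup>2 + (norm e)\<^sup>2 * (norm z)\<^sup>2
           + Re (2 * (norm z)\<^sup>2 * cnj e * (d - e) - 2 / (norm z)\<^sup>2 * cnj \<gamma> * z\<^sup>2 * d)"
proof -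
  have z: "norm z > 0" using assms by simp
  have "cnj (\<gamma> / z) = cnj \<gamma> * z / (norm z)\<^sup>2"
    using assms complex_norm_square[of z] by (simp add: field_simps)
  then have "Re (cnj (\<gamma> / z) * (z * d)) = Re (1 / (norm z)\<^sup>2 * cnj \<gamma> * z\<^sup>2 * d)"
    by (simp add: power2_eq_square mult_ac)
  then have 1: "(norm (z * d - \<gamma> / z))\<^sup>2 = (norm \<gamma>)\<^sup>2 / (norm z)\<^sup>2 + (norm d)\<^sup>2 * (norm z)\<^sup>2
           - 2 * Re (1 / (norm z)\<^sup>2 * cnj \<gamma> * z\<^sup>2 * d)"
    by (subst norm_minus_commute, subst norm_diff_squared_complex)
       (simp add: norm_mult norm_divide power_mult_distrib power_divide)
  have "0 \<le> (norm (d - e))\<^sup>2" by simp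
  also have "\<dots> = (norm d)\<^sup>2 - (norm e)\<^sup>2 - 2 * Re (cnj e * (d - e))"
    by (simp add: cmod_power2) (simp add: power2_eq_square algebra_simps)
  finally have "(norm d)\<^sup>2 \<ge> (norm e)\<^sup>2 + 2 * Re (cnj e * (d - e))" by simp
  then have "(norm d)\<^sup>2 * (norm z)\<^sup>2 \<ge> ((norm e)\<^sup>2 + 2 * Re (cnj e * (d - e))) * (norm z)\<^sup>2"
    by (rule mult_right_mono) simp
  moreover have "Re (2 * (norm z)\<^sup>2 * cnj e * (d - e) - 2 / (norm z)\<^sup>2 * cnj \<gamma> * z\<^sup>2 * d) =
     2 * Re (cnj e * (d - e)) * (norm z)\<^sup>2 - 2 * Re (1 / (norm z)\<^sup>2 * cnj \<gamma> * z\<^sup>2 * d)"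
  proof -
    have "2 * (norm z)\<^sup>2 * cnj e * (d - e) - 2 / (norm z)\<^sup>2 * cnj \<gamma> * z\<^sup>2 * d =
       complex_of_real (2 * (norm z)\<^sup>2) * (cnj e * (d - e)) - complex_of_real 2 * (1 / (norm z)\<^sup>2 * cnj \<gamma> * z\<^sup>2 * d)"
      by simp
    then show ?thesis
      by (simp only: minus_complex.sel Re_of_real_mult) (simp add: mult_ac)
  qed
  ultimately show ?thesis
    unfolding 1 by (simp add: algebra_simps)
qed

text \<open>The lower bound is the area, counted with multiplicity, of the image of the annulus
  under the truncation \<open>\<gamma> / z + deriv g 0 * z\<close>. With
  \<open>z = exp \<zeta>\<close> the annulus turns into a rectangle and the area into an integral of
  \<open>|deriv H|^2\<close>.\<close>

lemma area_annulus_image_ge: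
  fixes g :: "complex \<Rightarrow> complex" and \<gamma> :: complex
  defines "G \<equiv> \<lambda>z. \<gamma> / z + g z"
  assumes g: "g holomorphic_on ball 0 1" and inj: "inj_on G (ball 0 1 - {0})"
    and r: "0 < \<rho>" "\<rho> < r" "r < 1"
  shows "pi * ((norm \<gamma>)\<^sup>2 * (1 / \<rho>\<^sup>2 - 1 / r\<^sup>2) + (norm (deriv g 0))\<^sup>2 * (r\<^sup>2 - \<rho>\<^sup>2))
           \<le> measure lebesgue (G ` {z. \<rho> < norm z \<and> norm z < r})"
proof -
  define H where "H = (\<lambda>\<zeta>. \<gamma> * exp (- \<zeta>) + g (exp \<zeta>))"
  define a b where "a = ln \<rho>" and "b = ln r"
  define U where "U = {\<zeta>. Re \<zeta> < 0}"
  \<comment> \<open>The open rectangle has height \<open>2*pi\<close>, so \<open>exp\<close> is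
    injective on it and covers the annulus up to a radial slit.\<close>
  define B where "B = box (Complex a 0) (Complex b (2*pi))"
  define e where "e = deriv g 0"
  have ab: "a < b" "b < 0" "exp a = \<rho>" "exp b = r"
    using r by (auto simp: a_def b_def)
  have U: "open U" unfolding U_def by (rule open_halfspace_Re_lt)
  have exp_ball: "exp \<zeta> \<in> ball 0 1" if "\<zeta> \<in> U" for \<zeta>
    using that by (simp add: U_def)
  have holH: "H holomorphic_on U"
    unfolding H_def
    by (intro holomorphic_intros holomorphic_on_compose_gen[OF _ g, unfolded o_def])
       (use exp_ball in auto)
  have HG: "H \<zeta> = G (exp \<zeta>)" for \<zeta>
    by (simp add: H_def G_def exp_minus field_simps)
  have cbox_eq: "cbox (Complex a 0) (Complex b (2*pi)) = {\<zeta>. Re \<zeta> \<in> {a..b} \<and> Im \<zeta> \<in> {0..2*pi}}"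
    by (auto simp: mem_box Basis_complex_def)
  have B_eq: "B = {\<zeta>. Re \<zeta> \<in> {a<..<b} \<and> Im \<zeta> \<in> {0<..<2*pi}}"
    by (auto simp: B_def mem_box Basis_complex_def)
  have subU: "cbox (Complex a 0) (Complex b (2*pi)) \<subseteq> U"
    using ab by (auto simp: cbox_eq U_def)
  have injH: "inj_on H B"
  proof (rule inj_onI)
    fix u v assume uv: "u \<in> B" "v \<in> B" "H u = H v"
    then have "exp u = exp v"
      using ab(1,2) by - (rule inj_onD[OF inj], auto simp: HG B_eq)
    moreover have "\<bar>Im u - Im v\<bar> < 2 * pi"
      using uv by (auto simp: B_eq)
    ultimately show "u = v" by (rule exp_complex_eqI[rotated])
  qed
  have dH: "deriv H \<zeta> = exp \<zeta> * deriv g (exp \<zeta>) - \<gamma> / exp \<zeta>" if "\<zeta> \<in> U" for \<zeta>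
  proof -
    have "(g has_field_derivative deriv g (exp \<zeta>)) (at (exp \<zeta>))"
      using g exp_ball[OF that] by (intro holomorphic_derivI[OF g]) auto
    then have "((\<lambda>\<zeta>. g (exp \<zeta>)) has_field_derivative deriv g (exp \<zeta>) * exp \<zeta>) (at \<zeta>)"
      by (rule DERIV_chain2) (auto intro!: derivative_eq_intros)
    moreover have "((\<lambda>\<zeta>. \<gamma> * exp (- \<zeta>)) has_field_derivative - (\<gamma> * exp (- \<zeta>))) (at \<zeta>)"
      by (auto intro!: derivative_eq_intros)
    ultimately have "(H has_field_derivative - (\<gamma> * exp (- \<zeta>)) + deriv g (exp \<zeta>) * exp \<zeta>) (at \<zeta>)"
      unfolding H_def by (intro DERIV_add)
    then have "deriv H \<zeta> = - (\<gamma> * exp (- \<zeta>)) + deriv g (exp \<zeta>) * exp \<zeta>"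
      by (rule DERIV_imp_deriv)
    then show ?thesis by (simp add: exp_minus divide_inverse)
  qed
  \<comment> \<open>On the circle of radius \<open>exp x\<close> the factor \<open>|z|^2\<close> is
    the constant \<open>exp x ^ 2\<close>, so the error term of
    \<open>norm_deriv_lower_bound\<close> is \<open>Re (F x z)\<close> with \<open>F x\<close>
    holomorphic. As \<open>F x 0 = 0\<close>, its mean vanishes and only \<open>m x\<close> survives
    integration in \<open>y\<close>.\<close>
  define F where "F = (\<lambda>x z. 2 * complex_of_real (exp x ^ 2) * cnj e * (deriv g z - e)
      - 2 / complex_of_real (exp x ^ 2) * cnj \<gamma> * z\<^sup>2 * deriv g z)"
  define m where "m = (\<lambda>x. (norm \<gamma>)\<^sup>2 / (exp x)\<^sup>2 + (norm e)\<^sup>2 * (exp x)\<^sup>2)"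
  let ?C = "cbox (a, 0) (b, 2*pi)"
  let ?low = "\<lambda>(x, y). m x + Re (F x (exp (Complex x y)))"
  have C_U: "Complex x y \<in> U" if "(x, y) \<in> ?C" for x y
    using that ab by (auto simp: U_def)
  have holg': "deriv g holomorphic_on ball 0 1"
    by (intro holomorphic_deriv g) auto
  have contg': "continuous_on ?C (\<lambda>(x, y). deriv g (exp (Complex x y)))"
    unfolding case_prod_beta
    by (rule continuous_on_compose2[OF holomorphic_on_imp_continuous_on[OF holg']])
       (use ab in \<open>auto intro!: continuous_intros simp: Complex_eq\<close>)
  have cont_low: "continuous_on ?C ?low"
    using contg' unfolding case_prod_beta m_def F_def Complex_eq
    by (intro continuous_intros) auto
  have low_le: "?low v \<le> (\<lambda>(x, y). (norm (deriv H (Complex x y)))\<^sup>2) v" if "v \<in> ?C" for v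
  proof -
    obtain x y where v: "v = (x, y)" by force
    have "norm (exp (Complex x y)) = exp x" by simp
    with norm_deriv_lower_bound[of "exp (Complex x y)" \<gamma> e "deriv g (exp (Complex x y))"]
    show ?thesis
      using dH C_U that by (simp add: v m_def F_def)
  qed
  have contH: "continuous_on ?C (\<lambda>(x, y). (norm (deriv H (Complex x y)))\<^sup>2)"
  proof -
    have "continuous_on U (deriv H)"
      by (intro holomorphic_on_imp_continuous_on holomorphic_deriv holH U)
    then have "continuous_on ?C (\<lambda>v. deriv H (Complex (fst v) (snd v)))"
      by (rule continuous_on_compose2)
         (use C_U in \<open>auto intro!: continuous_intros simp: Complex_eq\<close>)
    then show ?thesis
      unfolding case_prod_beta by (intro continuous_intros)
  qed
  have inner: "integral (cbox 0 (2*pi)) (\<lambda>y. ?low (x, y)) = 2 * pi * m x" if "x \<in> cbox a b" for x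
  proof -
    have "F x holomorphic_on ball 0 1"
      unfolding F_def by (intro holomorphic_intros holg') auto
    then have "((\<lambda>t. F x (of_real (exp x) * cis t)) has_integral 2 * of_real pi * F x 0) {0..2*pi}"
      by (rule circle_mean_value) (use that ab in auto)
    moreover have "F x 0 = 0" by (simp add: F_def e_def)
    moreover have "of_real (exp x) * cis t = exp (Complex x t)" for t
      by (simp add: exp_eq_polar exp_of_real)
    ultimately have "((\<lambda>t. F x (exp (Complex x t))) has_integral 0) {0..2*pi}" by simp
    from has_integral_Re[OF this]
    have "((\<lambda>t. Re (F x (exp (Complex x t)))) has_integral 0) {0..2*pi}" by simp
    moreover have "((\<lambda>t. m x) has_integral (2 * pi - 0) *\<^sub>R m x) {0..2*pi}"
      using has_integral_const_real[of "m x" 0 "2*pi"] by simp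
    ultimately have "((\<lambda>t. m x + Re (F x (exp (Complex x t)))) has_integral (2 * pi - 0) *\<^sub>R m x + 0) {0..2*pi}"
      by (intro has_integral_add)
    then show ?thesis by (simp add: integral_unique)
  qed
  have outer: "((\<lambda>x. 2 * pi * m x) has_integral
      pi * ((norm \<gamma>)\<^sup>2 * (1 / \<rho>\<^sup>2 - 1 / r\<^sup>2) + (norm e)\<^sup>2 * (r\<^sup>2 - \<rho>\<^sup>2))) {a..b}"
  proof -
    define M where "M = (\<lambda>x. pi * ((norm e)\<^sup>2 * (exp x)\<^sup>2 - (norm \<gamma>)\<^sup>2 / (exp x)\<^sup>2))"
    have "((\<lambda>x. 2 * pi * m x) has_integral M b - M a) {a..b}"
    proof (rule fundamental_theorem_of_calculus)
      show "a \<le> b" using ab by simp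
      fix x
      have "(M has_real_derivative 2 * pi * m x) (at x)"
        unfolding M_def m_def
        by (rule derivative_eq_intros refl | simp)+ (simp add: field_simps power2_eq_square power4_eq_xxxx)
      then show "(M has_vector_derivative 2 * pi * m x) (at x within {a..b})"
        by (metis has_real_derivative_iff_has_vector_derivative has_vector_derivative_at_within)
    qed
    moreover have "M b - M a = pi * ((norm \<gamma>)\<^sup>2 * (1 / \<rho>\<^sup>2 - 1 / r\<^sup>2) + (norm e)\<^sup>2 * (r\<^sup>2 - \<rho>\<^sup>2))"
      by (simp add: M_def ab algebra_simps)
    ultimately show ?thesis by simp
  qed
  have "pi * ((norm \<gamma>)\<^sup>2 * (1 / \<rho>\<^sup>2 - 1 / r\<^sup>2) + (norm e)\<^sup>2 * (r\<^sup>2 - \<rho>\<^sup>2)) = integral (cbox a b) (\<lambda>x. 2 * pi * m x)"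
    using integral_unique[OF outer] by simp
  also have "\<dots> = integral (cbox a b) (\<lambda>x. integral (cbox 0 (2*pi)) (\<lambda>y. ?low (x, y)))"
    by (rule integral_cong) (use inner in auto)
  also have "\<dots> = integral ?C ?low"
    by (rule integral_prod_continuous[symmetric]) (rule cont_low)
  also have "\<dots> \<le> integral ?C (\<lambda>(x, y). (norm (deriv H (Complex x y)))\<^sup>2)"
    by (intro integral_le integrable_continuous cont_low contH low_le)
  also have "\<dots> = measure lebesgue (H ` B)"
    unfolding B_def
    by (rule measure_holomorphic_image_box[symmetric, OF U holH subU]) (use injH in \<open>simp add: B_def\<close>)
  also have "\<dots> \<le> measure lebesgue (G ` {z. \<rho> < norm z \<and> norm z < r})"
  proof (rule measure_mono_fmeasurable)
    show "H ` B \<subseteq> G ` {z. \<rho> < norm z \<and> norm z < r}"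
      by (auto simp: HG B_eq ab(3,4)[symmetric])
    show "H ` B \<in> sets lebesgue"
      using open_mapping_thm3[OF holomorphic_on_subset[OF holH] _ injH] subU box_subset_cbox
      by (force simp: B_def)
    let ?A = "{z::complex. \<rho> < norm z \<and> norm z < r}"
    have A: "open ?A"
      by (intro open_Collect_conj open_Collect_less continuous_intros)
    have holG: "G holomorphic_on ball 0 1 - {0}"
      unfolding G_def by (intro holomorphic_intros holomorphic_on_subset[OF g]) auto
    have sub: "?A \<subseteq> ball 0 1 - {0}" using r by auto
    have "open (G ` ?A)"
      by (rule open_mapping_thm3[OF holomorphic_on_subset[OF holG sub] A inj_on_subset[OF inj sub]])
    moreover have "bounded (G ` ?A)"
    proof (rule bounded_subset)
      have "compact (cball 0 r - ball 0 \<rho> :: complex set)"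
        by (intro compact_diff) auto
      moreover have "continuous_on (cball 0 r - ball 0 \<rho>) G"
        by (rule continuous_on_subset[OF holomorphic_on_imp_continuous_on[OF holG]]) (use r in auto)
      ultimately show "bounded (G ` (cball 0 r - ball 0 \<rho>))"
        by (intro compact_imp_bounded compact_continuous_image)
    qed auto
    ultimately show "G ` ?A \<in> lmeasurable"
      by (intro lmeasurable_open)
  qed
  finally show ?thesis by (simp add: e_def)
qed

section \<open>Ellipses and the values not taken near the pole\<close>

lemma norm_conj_linear_ge: "norm (w - \<kappa> * cnj w) \<ge> (1 - norm \<kappa>) * norm w"
  using norm_triangle_ineq2[of w "\<kappa> * cnj w"] by (simp add: norm_mult algebra_simps)

text \<open>After translation by \<open>c\<close> the set is the preimage of a disc of radius
  \<open>R\<close> under the real linear map \<open>L\<close>, whose determinant is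
  \<open>1 - |\<kappa>|^2\<close>. Linearity gives convexity, and \<open>norm_conj_linear_ge\<close>
  gives boundedness.\<close>

lemma area_ellipse:
  fixes c \<kappa> :: complex
  assumes \<kappa>: "norm \<kappa> < 1" and R: "R \<ge> 0"
  defines "S \<equiv> {w. norm ((w - c) - \<kappa> * cnj (w - c)) \<le> R}"
  shows "compact S" and "convex S" and "measure lebesgue S = pi * R\<^sup>2 / (1 - (norm \<kappa>)\<^sup>2)"
proof -
  define L where "L = (\<lambda>w. w - \<kappa> * cnj w)"
  define S' where "S' = {w. norm (L w) \<le> R}"
  have k2: "1 - (norm \<kappa>)\<^sup>2 > 0"
    using \<kappa> by (simp add: abs_square_less_1)
  have lin: "linear L"
    by (rule linearI) (simp_all add: L_def algebra_simps scaleR_conv_of_real)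
  have S_eq: "S = (+) c ` S'"
  proof -
    have "w \<in> S \<longleftrightarrow> w - c \<in> S'" for w by (simp add: S_def S'_def L_def)
    moreover have "w = c + (w - c)" for w by simp
    ultimately show ?thesis by (auto simp del: add_diff_cancel_left intro: rev_image_eqI)
  qed
  have "S' \<subseteq> cball 0 (R / (1 - norm \<kappa>))"
  proof
    fix w assume "w \<in> S'"
    then have "(1 - norm \<kappa>) * norm w \<le> R"
      using norm_conj_linear_ge[where w = w and \<kappa> = \<kappa>] by (simp add: S'_def L_def)
    then show "w \<in> cball 0 (R / (1 - norm \<kappa>))"
      using \<kappa> by (simp add: field_simps)
  qed
  moreover have "closed S'"
    unfolding S'_def L_def by (intro closed_Collect_le continuous_intros)
  ultimately have cS': "compact S'"
    using bounded_subset bounded_cball by (auto simp: compact_eq_bounded_closed)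
  then show "compact S" unfolding S_eq by (rule compact_translation)
  have "S' = L -` cball 0 R" by (auto simp: S'_def)
  then have "convex S'" using convex_linear_vimage[OF lin convex_cball] by simp
  then show "convex S" unfolding S_eq by (rule convex_translation)
  have "L ` S' = cball 0 R"
  proof
    show "L ` S' \<subseteq> cball 0 R" by (auto simp: S'_def)
    show "cball 0 R \<subseteq> L ` S'"
    proof
      fix v :: complex assume v: "v \<in> cball 0 R"
      \<comment> \<open>The inverse of \<open>L\<close>, found by solving
        \<open>u - \<kappa> * cnj u = v\<close> together with its conjugate equation.\<close>
      define u where "u = (v + \<kappa> * cnj v) / of_real (1 - (norm \<kappa>)\<^sup>2)"
      have "L u = v"
      proof -
        have nz: "complex_of_real (1 - (norm \<kappa>)\<^sup>2) \<noteq> 0" using k2 by (simp only: of_real_eq_0_iff)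
        have "L u = (v + \<kappa> * cnj v - \<kappa> * (cnj v + cnj \<kappa> * v)) / of_real (1 - (norm \<kappa>)\<^sup>2)"
          by (simp add: L_def u_def diff_divide_distrib)
        also have "v + \<kappa> * cnj v - \<kappa> * (cnj v + cnj \<kappa> * v) = v * of_real (1 - (norm \<kappa>)\<^sup>2)"
          by (simp add: complex_norm_square[of \<kappa>, symmetric] algebra_simps)
        finally show ?thesis using nz by (metis nonzero_mult_div_cancel_right)
      qed
      with v show "v \<in> L ` S'" by (auto simp: S'_def image_iff intro!: exI[of _ u])
    qed
  qed
  then have "measure lebesgue (L ` S') = pi * R\<^sup>2"
    using R by (simp add: content_cball unit_ball_vol_2)
  moreover have "Re (L 1) * Im (L \<i>) - Im (L 1) * Re (L \<i>) = 1 - (norm \<kappa>)\<^sup>2"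
    by (simp add: L_def cmod_power2) (simp add: algebra_simps power2_eq_square)
  ultimately have "pi * R\<^sup>2 = (1 - (norm \<kappa>)\<^sup>2) * measure lebesgue S'"
    using measure_linear_image_complex[OF lin cS'] k2 by simp
  moreover have "measure lebesgue S = measure lebesgue S'"
    unfolding S_eq by (rule measure_translation)
  ultimately show "measure lebesgue S = pi * R\<^sup>2 / (1 - (norm \<kappa>)\<^sup>2)"
    using k2 by (simp add: field_simps)
qed

text \<open>A connectedness argument takes the place of winding numbers. The complement of the
  ellipse \<open>S\<close> is connected because \<open>S\<close> is bounded and convex. Within it
  the image of the punctured disc is open and relatively closed, and it is nonempty because of the
  pole; hence it is the whole complement.\<close>

lemma omitted_values_in_ellipse:
  fixes g :: "complex \<Rightarrow> complex" and \<gamma> :: complex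
  defines "G \<equiv> \<lambda>z. \<gamma> / z + g z"
  assumes g: "g holomorphic_on ball 0 1" and inj: "inj_on G (ball 0 1 - {0})" and \<gamma>: "\<gamma> \<noteq> 0"
    and \<rho>: "0 < \<rho>" "\<rho> < 1" and \<kappa>: "norm \<kappa> < 1"
    and R: "\<And>z. norm z = \<rho> \<Longrightarrow> norm ((G z - c) - \<kappa> * cnj (G z - c)) \<le> R"
  shows "- G ` (cball 0 \<rho> - {0}) \<subseteq> {w. norm ((w - c) - \<kappa> * cnj (w - c)) \<le> R}"
proof -
  define S where "S = {w. norm ((w - c) - \<kappa> * cnj (w - c)) \<le> R}"
  have R0: "R \<ge> 0"
    using order_trans[OF norm_ge_zero R[of "of_real \<rho>"]] \<rho> by simp
  have holG: "G holomorphic_on ball 0 1 - {0}"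
    unfolding G_def by (intro holomorphic_intros holomorphic_on_subset[OF g]) auto
  have contg: "continuous_on (cball 0 \<rho>) g"
    by (rule continuous_on_subset[OF holomorphic_on_imp_continuous_on[OF g]]) (use \<rho> in auto)
  have conn: "connected (- S)"
    using area_ellipse[OF \<kappa> R0, of c] unfolding S_def
    by (intro connected_complement_bounded_convex compact_imp_bounded) auto
  have sub: "ball 0 \<rho> - {0} \<subseteq> ball 0 1 - {0::complex}" using \<rho> by auto
  have open_img: "open (G ` (ball 0 \<rho> - {0}))"
    by (rule open_mapping_thm3[OF holomorphic_on_subset[OF holG sub] _ inj_on_subset[OF inj sub]])
       (auto intro: open_delete)
  have closed_img: "closed (G ` (cball 0 \<rho> - {0}))"
  proof -
    \<comment> \<open>Clearing the pole exhibits the image as a projection of a closed set along a compact factor.\<close>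
    let ?T = "{v \<in> cball 0 \<rho> \<times> UNIV. \<gamma> + fst v * (g (fst v) - snd v) = 0}"
    have "closed ?T"
      by (intro continuous_closed_preimage_constant closed_Times closed_cball closed_UNIV
            continuous_intros continuous_on_compose2[OF contg]) auto
    from closed_compact_projection[OF compact_cball[of 0 \<rho>] this]
    have "closed {w. \<exists>z. z \<in> cball 0 \<rho> \<and> (z, w) \<in> ?T}" .
    also have "{w. \<exists>z. z \<in> cball 0 \<rho> \<and> (z, w) \<in> ?T} = G ` (cball 0 \<rho> - {0})"
    proof -
      have "\<gamma> + z * (g z - w) = 0 \<longleftrightarrow> z \<noteq> 0 \<and> w = G z" for z w
        using \<gamma> by (cases "z = 0") (auto simp: G_def field_simps add_eq_0_iff)
      then show ?thesis by (auto simp: image_iff)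
    qed
    finally show ?thesis .
  qed
  have meet: "\<exists>w. w \<in> - S \<and> w \<in> G ` (ball 0 \<rho> - {0})"
  proof -
    have "bounded (g ` cball 0 \<rho>)"
      by (intro compact_imp_bounded compact_continuous_image contg) auto
    then obtain M where M: "M > 0" "\<And>z. z \<in> cball 0 \<rho> \<Longrightarrow> norm (g z) \<le> M"
      by (auto simp: bounded_pos)
    \<comment> \<open>Chosen so that \<open>norm \<gamma> / t \<ge> Q\<close> forces
      \<open>G t\<close> to be farther from \<open>c\<close> than
      \<open>R / (1 - norm \<kappa>)\<close>, the radius beyond which
      \<open>norm_conj_linear_ge\<close> excludes membership in \<open>S\<close>.\<close>
    define Q where "Q = M + norm c + R / (1 - norm \<kappa>) + 1"
    have "R / (1 - norm \<kappa>) \<ge> 0" using R0 \<kappa> by simp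
    then have Q: "Q > 0" using M by (simp add: Q_def add_pos_nonneg add_nonneg_pos)
    define t where "t = min (\<rho> / 2) (norm \<gamma> / Q)"
    have t: "0 < t" "t < \<rho>" "t \<le> norm \<gamma> / Q" using \<rho> Q \<gamma> by (auto simp: t_def)
    have "Q \<le> norm \<gamma> / t" using t Q by (simp add: field_simps)
    also have "\<dots> = norm (\<gamma> / of_real t)" using t by (simp add: norm_divide)
    also have "\<gamma> / of_real t = (G (of_real t) - c) - (g (of_real t) - c)" by (simp add: G_def)
    also have "norm \<dots> \<le> norm (G (of_real t) - c) + (norm (g (of_real t)) + norm c)"
      by (meson add_left_mono norm_triangle_ineq4 order_trans)
    also have "norm (g (of_real t)) \<le> M" using t by (intro M) auto
    finally have "norm (G (of_real t) - c) > R / (1 - norm \<kappa>)"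
      by (simp add: Q_def)
    then have "(1 - norm \<kappa>) * norm (G (of_real t) - c) > R"
      using \<kappa> by (simp add: field_simps)
    with norm_conj_linear_ge[where w = "G (of_real t) - c" and \<kappa> = \<kappa>]
    have "G (of_real t) \<in> - S" by (simp add: S_def)
    moreover have "of_real t \<in> ball 0 \<rho> - {0::complex}" using t by auto
    ultimately show ?thesis by blast
  qed
  \<comment> \<open>The circle itself is sent into \<open>S\<close>, so outside \<open>S\<close> the
    images of the open and of the closed punctured disc agree.\<close>
  have split: "G ` (cball 0 \<rho> - {0}) \<subseteq> G ` (ball 0 \<rho> - {0}) \<union> S"
  proof clarify
    fix z assume z: "z \<in> cball 0 \<rho>" "G z \<notin> S" "z \<noteq> 0"
    then have "norm z \<noteq> \<rho>" using R by (auto simp: S_def)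
    with z show "G z \<in> G ` (ball 0 \<rho> - {0})" by auto
  qed
  have "- S \<subseteq> G ` (cball 0 \<rho> - {0})"
  proof (rule ccontr)
    assume "\<not> - S \<subseteq> G ` (cball 0 \<rho> - {0})"
    then have "- G ` (cball 0 \<rho> - {0}) \<inter> - S \<noteq> {}" by auto
    moreover have "G ` (ball 0 \<rho> - {0}) \<inter> - G ` (cball 0 \<rho> - {0}) \<inter> - S = {}" by fastforce
    moreover have "- S \<subseteq> G ` (ball 0 \<rho> - {0}) \<union> - G ` (cball 0 \<rho> - {0})"
      using split by auto
    moreover have "open (- G ` (cball 0 \<rho> - {0}))" using closed_img by (simp add: open_Compl)
    ultimately show False
      using connectedD[OF conn open_img] meet by blast
  qed
  then show ?thesis unfolding S_def by blast
qed

section \<open>The area inequality and its limit\<close>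

text \<open>Taylor's formula of order one, the second derivative being bounded on the compact disc
  of radius 1/2.\<close>

lemma holomorphic_quadratic_remainder:
  assumes g: "g holomorphic_on ball 0 1"
  obtains C where "C \<ge> 0" "\<And>z. norm z \<le> 1/2 \<Longrightarrow> norm (g z - g 0 - deriv g 0 * z) \<le> C * (norm z)\<^sup>2"
proof -
  have h1: "deriv g holomorphic_on ball 0 1" and h2: "deriv (deriv g) holomorphic_on ball 0 1"
    by (intro holomorphic_deriv g; simp)+
  have "continuous_on (cball 0 (1/2)) (deriv (deriv g))"
    by (rule continuous_on_subset[OF holomorphic_on_imp_continuous_on[OF h2]]) auto
  then have "bounded (deriv (deriv g) ` cball 0 (1/2))"
    by (intro compact_imp_bounded compact_continuous_image) auto
  then obtain C where C: "C > 0" "\<And>z. z \<in> cball 0 (1/2) \<Longrightarrow> norm (deriv (deriv g) z) \<le> C"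
    by (auto simp: bounded_pos)
  define f where "f = (\<lambda>i::nat. if i = 0 then g else if i = 1 then deriv g else deriv (deriv g))"
  have "norm (g z - g 0 - deriv g 0 * z) \<le> C * (norm z)\<^sup>2" if "norm z \<le> 1/2" for z
  proof -
    have "norm (f 0 z - (\<Sum>i\<le>1. f i 0 * (z - 0) ^ i / fact i)) \<le> C * norm (z - 0) ^ Suc 1 / fact 1"
    proof (rule complex_Taylor[where S = "cball 0 (1/2)"])
      fix i :: nat and x :: complex assume x: "x \<in> cball 0 (1/2)" and "i \<le> 1"
      then have "x \<in> ball 0 1" by simp
      then have "(f i has_field_derivative f (Suc i) x) (at x)"
        using \<open>i \<le> 1\<close> holomorphic_derivI[OF g, of x] holomorphic_derivI[OF h1, of x]
        by (cases "i = 0") (auto simp: f_def)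
      then show "(f i has_field_derivative f (Suc i) x) (at x within cball 0 (1/2))"
        by (rule has_field_derivative_at_within)
    qed (use C that in \<open>auto simp: f_def\<close>)
    then show ?thesis by (simp add: f_def power2_eq_square algebra_simps)
  qed
  with C that show ?thesis by (metis less_imp_le)
qed

text \<open>By injectivity the image of the annulus avoids the image of
  \<open>cball 0 \<rho> - {0}\<close>, as \<open>K\<close> does; both therefore fit disjointly into
  the ellipse. The parameters \<open>c\<close>, \<open>\<kappa>\<close> and \<open>R\<close> stay
  free, to be fitted to the image of the circle.\<close>

lemma area_theorem_inequality:
  fixes g :: "complex \<Rightarrow> complex" and \<gamma> :: complex
  defines "G \<equiv> \<lambda>z. \<gamma> / z + g z"
  assumes g: "g holomorphic_on ball 0 1" and inj: "inj_on G (ball 0 1 - {0})" and \<gamma>: "\<gamma> \<noteq> 0"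
    and K: "K \<in> sets lebesgue" "K \<inter> G ` (ball 0 1 - {0}) = {}"
    and \<rho>: "0 < \<rho>" "\<rho> < r" "r < 1" and \<kappa>: "norm \<kappa> < 1"
    and R: "\<And>z. norm z = \<rho> \<Longrightarrow> norm ((G z - c) - \<kappa> * cnj (G z - c)) \<le> R"
  shows "measure lebesgue K + pi * ((norm \<gamma>)\<^sup>2 * (1 / \<rho>\<^sup>2 - 1 / r\<^sup>2) + (norm (deriv g 0))\<^sup>2 * (r\<^sup>2 - \<rho>\<^sup>2))
           \<le> pi * R\<^sup>2 / (1 - (norm \<kappa>)\<^sup>2)"
proof -
  let ?A = "{z::complex. \<rho> < norm z \<and> norm z < r}"
  define S where "S = {w. norm ((w - c) - \<kappa> * cnj (w - c)) \<le> R}"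
  have R0: "R \<ge> 0"
    using order_trans[OF norm_ge_zero R[of "of_real \<rho>"]] \<rho> by simp
  have holG: "G holomorphic_on ball 0 1 - {0}"
    unfolding G_def by (intro holomorphic_intros holomorphic_on_subset[OF g]) auto
  have A: "open ?A"
    by (intro open_Collect_conj open_Collect_less continuous_intros)
  have sub: "?A \<subseteq> ball 0 1 - {0}" "cball 0 \<rho> - {0} \<subseteq> ball 0 1 - {0::complex}" using \<rho> by auto
  have GA: "open (G ` ?A)"
    by (rule open_mapping_thm3[OF holomorphic_on_subset[OF holG sub(1)] A inj_on_subset[OF inj sub(1)]])
  have outer: "- G ` (cball 0 \<rho> - {0}) \<subseteq> S"
    unfolding S_def G_def
    by (rule omitted_values_in_ellipse) (use g inj \<gamma> \<rho> \<kappa> R in \<open>auto simp: G_def\<close>)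
  have "K \<subseteq> - G ` (cball 0 \<rho> - {0})"
    using K(2) sub(2) by blast
  moreover have "G ` ?A \<subseteq> - G ` (cball 0 \<rho> - {0})"
    using inj_onD[OF inj] sub by force
  ultimately have KS: "K \<subseteq> S" and AS: "G ` ?A \<subseteq> S" using outer by auto
  have S: "S \<in> lmeasurable"
    using area_ellipse(1)[OF \<kappa> R0, of c] by (simp add: S_def lmeasurable_compact)
  have Km: "K \<in> lmeasurable" and Am: "G ` ?A \<in> lmeasurable"
    using KS AS K GA S by (auto intro: fmeasurableI2)
  have "measure lebesgue K + measure lebesgue (G ` ?A) = measure lebesgue (K \<union> G ` ?A)"
  proof -
    have "G ` ?A - K = G ` ?A" using K(2) sub(1) by blast
    then show ?thesis using measure_Un2[OF Km Am] by simp
  qed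
  also have "\<dots> \<le> measure lebesgue S"
    using KS AS S K GA by (intro measure_mono_fmeasurable) auto
  also have "\<dots> = pi * R\<^sup>2 / (1 - (norm \<kappa>)\<^sup>2)"
    unfolding S_def by (rule area_ellipse(3)[OF \<kappa> R0])
  finally show ?thesis
    using area_annulus_image_ge[OF g _ \<rho>, of \<gamma>] inj by (simp add: G_def)
qed

text \<open>Both sides of \<open>area_theorem_inequality\<close> grow like
  \<open>pi * |\<gamma>|^2 / \<rho>^2\<close> as \<open>\<rho>\<close> tends to 0. With an ellipse
  of the right eccentricity these terms cancel up to an error tending to 0.\<close>

theorem area_theorem:
  fixes g :: "complex \<Rightarrow> complex" and \<gamma> :: complex
  assumes g: "g holomorphic_on ball 0 1" and inj: "inj_on (\<lambda>z. \<gamma> / z + g z) (ball 0 1 - {0})"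
    and \<gamma>: "\<gamma> \<noteq> 0"
    and K: "K \<in> sets lebesgue" "K \<inter> (\<lambda>z. \<gamma> / z + g z) ` (ball 0 1 - {0}) = {}"
  shows "measure lebesgue K \<le> pi * ((norm \<gamma>)\<^sup>2 - (norm (deriv g 0))\<^sup>2)"
proof -
  define n E where "n = norm \<gamma>" and "E = norm (deriv g 0)"
  have n: "n > 0" using \<gamma> by (simp add: n_def)
  have E: "E \<ge> 0" by (simp add: E_def)
  obtain C where C: "C \<ge> 0"
      "\<And>z. norm z \<le> 1/2 \<Longrightarrow> norm (g z - g 0 - deriv g 0 * z) \<le> C * (norm z)\<^sup>2"
    using holomorphic_quadratic_remainder[OF g] by blast
  \<comment> \<open>The circle of radius \<open>\<rho>\<close> will satisfy the ellipse bound with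
    \<open>R = n / \<rho> + \<rho>^2 * D \<rho>\<close>. Then \<open>err \<rho>\<close> is what
    remains of \<open>R^2 / (1 - |\<kappa>|^2)\<close> after subtracting
    \<open>n^2 / \<rho>^2\<close>.\<close>
  define D where "D = (\<lambda>\<rho>. C + E / n * (E * \<rho> + C * \<rho>\<^sup>2))"
  define err where "err = (\<lambda>\<rho>. (2 * n * \<rho> * D \<rho> + \<rho> ^ 4 * (D \<rho>)\<^sup>2 + E\<^sup>2 * \<rho>\<^sup>2) / (1 - (E * \<rho>\<^sup>2 / n)\<^sup>2))"
  have bound: "measure lebesgue K \<le> pi * (n\<^sup>2 / r\<^sup>2 - E\<^sup>2 * (r\<^sup>2 - \<rho>\<^sup>2) + err \<rho>)"
    if \<rho>: "0 < \<rho>" "\<rho> < r" "\<rho> < 1/2" "E * \<rho>\<^sup>2 / n < 1" and r: "r < 1" for \<rho> r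
  proof -
    \<comment> \<open>On \<open>|z| = \<rho>\<close> the map \<open>w \<mapsto> w - \<kappa> cnj w\<close> cancels the term \<open>g' 0 * z\<close>, so that the image curve becomes a circle up to \<open>O(\<rho>\<^sup>2)\<close>.\<close>
    define \<kappa> where "\<kappa> = deriv g 0 * of_real (\<rho>\<^sup>2) / cnj \<gamma>"
    have norm_\<kappa>: "norm \<kappa> = E * \<rho>\<^sup>2 / n"
      by (simp add: \<kappa>_def norm_mult norm_divide E_def n_def norm_power)
    have k2: "1 - (E * \<rho>\<^sup>2 / n)\<^sup>2 > 0"
      using \<rho>(4) E n by (simp add: abs_square_less_1)
    define R where "R = n / \<rho> + \<rho>\<^sup>2 * D \<rho>"
    have "measure lebesgue K + pi * ((norm \<gamma>)\<^sup>2 * (1 / \<rho>\<^sup>2 - 1 / r\<^sup>2) + (norm (deriv g 0))\<^sup>2 * (r\<^sup>2 - \<rho>\<^sup>2))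
           \<le> pi * R\<^sup>2 / (1 - (norm \<kappa>)\<^sup>2)"
    proof (rule area_theorem_inequality[where c = "g 0"])
      show "norm \<kappa> < 1" using \<rho> by (simp add: norm_\<kappa>)
      fix z :: complex assume z: "norm z = \<rho>"
      then have z0: "z \<noteq> 0" using \<rho> by auto
      define \<delta> where "\<delta> = g z - g 0 - deriv g 0 * z"
      have \<delta>: "norm \<delta> \<le> C * \<rho>\<^sup>2"
        unfolding \<delta>_def using C(2)[of z] z \<rho> by simp
      have eq: "\<gamma> / z + g z - g 0 = \<gamma> / z + deriv g 0 * z + \<delta>" by (simp add: \<delta>_def)
      have "\<kappa> * cnj (\<gamma> / z) = deriv g 0 * z"
      proof -
        have "of_real (\<rho>\<^sup>2) = z * cnj z" using z complex_norm_square[of z] by simp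
        then show ?thesis using z0 \<gamma> by (simp add: \<kappa>_def field_simps)
      qed
      then have "\<gamma> / z + g z - g 0 - \<kappa> * cnj (\<gamma> / z + g z - g 0) =
          \<gamma> / z + \<delta> - \<kappa> * cnj (deriv g 0 * z + \<delta>)"
        unfolding eq by (simp add: algebra_simps)
      also have "norm \<dots> \<le> norm (\<gamma> / z) + norm \<delta> + norm \<kappa> * (norm (deriv g 0 * z) + norm \<delta>)"
      proof -
        have "norm (\<kappa> * cnj (deriv g 0 * z + \<delta>)) \<le> norm \<kappa> * (norm (deriv g 0 * z) + norm \<delta>)"
          using norm_triangle_ineq[of "deriv g 0 * z" \<delta>]
          by (simp only: norm_mult[of \<kappa>] complex_mod_cnj mult_left_mono norm_ge_zero)
        then show ?thesis
          using norm_triangle_ineq4[of "\<gamma> / z + \<delta>" "\<kappa> * cnj (deriv g 0 * z + \<delta>)"]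
            norm_triangle_ineq[of "\<gamma> / z" \<delta>] by linarith
      qed
      also have "\<dots> \<le> n / \<rho> + C * \<rho>\<^sup>2 + norm \<kappa> * (E * \<rho> + C * \<rho>\<^sup>2)"
        using \<delta> z by (intro add_mono mult_left_mono) (auto simp: norm_divide norm_mult n_def E_def)
      also have "\<dots> = R"
        by (simp add: R_def D_def norm_\<kappa> algebra_simps)
      finally show "norm (\<gamma> / z + g z - g 0 - \<kappa> * cnj (\<gamma> / z + g z - g 0)) \<le> R" .
    qed (use assms \<rho> r in auto)
    moreover have "R\<^sup>2 / (1 - (E * \<rho>\<^sup>2 / n)\<^sup>2) = n\<^sup>2 / \<rho>\<^sup>2 + err \<rho>"
    proof -
      have "R\<^sup>2 = n\<^sup>2 / \<rho>\<^sup>2 * (1 - (E * \<rho>\<^sup>2 / n)\<^sup>2) + (2 * n * \<rho> * D \<rho> + \<rho> ^ 4 * (D \<rho>)\<^sup>2 + E\<^sup>2 * \<rho>\<^sup>2)"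
        using n \<rho> by (simp add: R_def field_simps power2_eq_square power4_eq_xxxx)
      then show ?thesis using k2 by (simp add: err_def add_divide_distrib)
    qed
    then have "pi * R\<^sup>2 / (1 - (E * \<rho>\<^sup>2 / n)\<^sup>2) = pi * (n\<^sup>2 / \<rho>\<^sup>2 + err \<rho>)"
      by (metis times_divide_eq_right)
    ultimately show ?thesis
      by (simp add: norm_\<kappa> n_def[symmetric] E_def[symmetric] algebra_simps)
  qed
  \<comment> \<open>First \<open>\<rho>\<close> tends to 0 with \<open>r\<close> fixed: each term in
    the numerator of \<open>err\<close> carries a factor \<open>\<rho>\<close> while
    \<open>D\<close> stays bounded and the denominator tends to 1. Letting \<open>r\<close> tend to
    1 comes afterwards.\<close>
  have lim_r: "measure lebesgue K \<le> pi * (n\<^sup>2 / r\<^sup>2 - E\<^sup>2 * r\<^sup>2)" if r: "0 < r" "r < 1" for r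
  proof (rule tendsto_lowerbound)
    have "(err \<longlongrightarrow> (2 * n * 0 * D 0 + 0 ^ 4 * (D 0)\<^sup>2 + E\<^sup>2 * 0\<^sup>2) / (1 - (E * 0\<^sup>2 / n)\<^sup>2)) (at_right 0)"
      unfolding err_def D_def using n by (intro tendsto_intros) auto
    then have "((\<lambda>\<rho>. pi * (n\<^sup>2 / r\<^sup>2 - E\<^sup>2 * (r\<^sup>2 - \<rho>\<^sup>2) + err \<rho>)) \<longlongrightarrow>
          pi * (n\<^sup>2 / r\<^sup>2 - E\<^sup>2 * (r\<^sup>2 - 0\<^sup>2) + 0)) (at_right 0)"
      using r by (intro tendsto_intros) auto
    then show "((\<lambda>\<rho>. pi * (n\<^sup>2 / r\<^sup>2 - E\<^sup>2 * (r\<^sup>2 - \<rho>\<^sup>2) + err \<rho>)) \<longlongrightarrow>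
          pi * (n\<^sup>2 / r\<^sup>2 - E\<^sup>2 * r\<^sup>2)) (at_right 0)" by simp
    have "((\<lambda>\<rho>. E * \<rho>\<^sup>2 / n) \<longlongrightarrow> E * 0\<^sup>2 / n) (at_right 0)"
      using n by (intro tendsto_intros) auto
    then have "\<forall>\<^sub>F \<rho> in at_right 0. E * \<rho>\<^sup>2 / n < 1"
      by (rule order_tendstoD) auto
    moreover have "\<forall>\<^sub>F \<rho> in at_right 0. \<rho> \<in> {0<..<min r (1/2)}"
      by (rule eventually_at_right_real) (use r in auto)
    ultimately show "\<forall>\<^sub>F \<rho> in at_right 0. measure lebesgue K \<le> pi * (n\<^sup>2 / r\<^sup>2 - E\<^sup>2 * (r\<^sup>2 - \<rho>\<^sup>2) + err \<rho>)"
      by eventually_elim (use bound r in auto)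
  qed simp
  have "measure lebesgue K \<le> pi * (n\<^sup>2 / 1\<^sup>2 - E\<^sup>2 * 1\<^sup>2)"
  proof (rule tendsto_lowerbound)
    show "((\<lambda>r. pi * (n\<^sup>2 / r\<^sup>2 - E\<^sup>2 * r\<^sup>2)) \<longlongrightarrow> pi * (n\<^sup>2 / 1\<^sup>2 - E\<^sup>2 * 1\<^sup>2)) (at_left 1)"
      by (intro tendsto_intros) auto
    have "\<forall>\<^sub>F r in at_left 1. r \<in> {0<..<1::real}"
      by (rule eventually_at_left_real) auto
    then show "\<forall>\<^sub>F r in at_left 1. measure lebesgue K \<le> pi * (n\<^sup>2 / r\<^sup>2 - E\<^sup>2 * r\<^sup>2)"
      by eventually_elim (use lim_r in auto)
  qed simp
  then show ?thesis by (simp add: n_def E_def)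
qed

text \<open>The area of the empty set is 0, so the bound in the area theorem is nonnegative.\<close>

corollary univalent_pole_coefficient_bound:
  fixes g :: "complex \<Rightarrow> complex" and \<gamma> :: complex
  assumes "g holomorphic_on ball 0 1" "inj_on (\<lambda>z. \<gamma> / z + g z) (ball 0 1 - {0})" "\<gamma> \<noteq> 0"
  shows "norm (deriv g 0) \<le> norm \<gamma>"
proof -
  have "0 \<le> pi * ((norm \<gamma>)\<^sup>2 - (norm (deriv g 0))\<^sup>2)"
    using area_theorem[OF assms, of "{}"] by simp
  then show ?thesis
    using pi_gt_zero by (auto simp: zero_le_mult_iff power2_le_iff_abs_le)
qed

section \<open>Coefficients of conformal maps\<close>

text \<open>The difference of the values at \<open>u\<close> and \<open>v\<close> is
  \<open>(v - u) * (1 - s * u * v) / (u * v)\<close>, and \<open>|s * u * v| < 1\<close> inside the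
  disc.\<close>

lemma inj_on_Joukowski:
  fixes s :: real
  assumes s: "\<bar>s\<bar> = 1"
  shows "inj_on (\<lambda>u::complex. 1 / u + of_real s * u) (ball 0 1 - {0})"
proof (rule inj_onI)
  fix u v :: complex
  assume uv: "u \<in> ball 0 1 - {0}" "v \<in> ball 0 1 - {0}" "1 / u + of_real s * u = 1 / v + of_real s * v"
  have "norm u * norm v < 1"
    using uv mult_strict_mono[of "norm u" 1 "norm v" 1] by simp
  then have "norm (of_real s * u * v) \<noteq> 1" using s by (simp add: norm_mult)
  then have "1 - of_real s * u * v \<noteq> 0" by auto
  moreover have "(v - u) * (1 - of_real s * u * v) = u * v * ((1 / u + of_real s * u) - (1 / v + of_real s * v))"
    using uv by (simp add: field_simps)
  ultimately show "u = v" using uv by simp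
qed

text \<open>Injectivity makes the zero at 0 simple and the only one. Hence \<open>h\<close>, which
  is \<open>f z / z\<close> with its singularity removed, has no zeros, and
  \<open>1 / f z = k z / z\<close> with \<open>k = 1 / h\<close> holomorphic; \<open>g\<close> is
  the difference quotient of \<open>k\<close> at 0.\<close>

lemma reciprocal_univalent_expansion:
  assumes f: "f holomorphic_on ball 0 1" and inj: "inj_on f (ball 0 1)" and f0: "f 0 = 0"
  obtains \<gamma> g where "g holomorphic_on ball 0 1" "\<gamma> \<noteq> 0"
    "\<And>z. z \<in> ball 0 1 - {0} \<Longrightarrow> f z \<noteq> 0 \<and> 1 / f z = \<gamma> / z + g z"
proof -
  have nz: "f z \<noteq> 0" if "z \<in> ball 0 1 - {0}" for z
    using inj_onD[OF inj, of z 0] that f0 by auto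
  have d0: "deriv f 0 \<noteq> 0"
    by (rule holomorphic_injective_imp_regular[OF f _ inj]) auto
  define h where "h = (\<lambda>z. if z = 0 then deriv f 0 else f z / z)"
  have hh: "h holomorphic_on ball 0 1"
    by (rule pole_theorem_open_0[OF f, where a = 0]) (auto simp: h_def f0)
  have h_nz: "h z \<noteq> 0" if "z \<in> ball 0 1" for z
    using nz[of z] d0 that by (auto simp: h_def)
  define k where "k = (\<lambda>z. 1 / h z)"
  have kh: "k holomorphic_on ball 0 1"
    unfolding k_def by (intro holomorphic_intros hh) (use h_nz in auto)
  define g where "g = (\<lambda>z. if z = 0 then deriv k 0 else k z / z - k 0 / (z - 0))"
  show ?thesis
  proof
    show "g holomorphic_on ball 0 1"
      unfolding g_def by (rule pole_theorem_open[OF kh]) auto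
    show "k 0 \<noteq> 0" using d0 by (simp add: k_def h_def)
    fix z :: complex assume z: "z \<in> ball 0 1 - {0}"
    then show "f z \<noteq> 0 \<and> 1 / f z = k 0 / z + g z"
      using nz[OF z] by (auto simp: g_def k_def h_def field_simps)
  qed
qed

text \<open>Compare the coefficients of orders 1, 2 and 3 in
  \<open>f z * (\<gamma> + z * g z) = z\<close>.\<close>

lemma reciprocal_coefficients:
  fixes b :: "nat \<Rightarrow> complex"
  assumes sums: "\<And>z. z \<in> ball 0 1 \<Longrightarrow> (\<lambda>n. b (Suc n) * z ^ Suc n) sums f z"
    and g: "g holomorphic_on ball 0 1"
    and fg: "\<And>z. z \<in> ball 0 1 - {0} \<Longrightarrow> f z \<noteq> 0 \<and> 1 / f z = \<gamma> / z + g z"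
  shows "deriv f 0 = b 1" and "b 1 * \<gamma> = 1" and "deriv g 0 = (b 2 ^ 2 / b 1 - b 3) / b 1 ^ 2"
proof -
  \<comment> \<open>The constant coefficient is set to 0 by hand: the series starts at
    \<open>b 1\<close>, so \<open>b 0\<close> is arbitrary.\<close>
  define F where "F = Abs_fps (\<lambda>n. if n = 0 then 0 else b n)"
  define H where "H = fps_expansion g 0"
  have nhds: "eventually (\<lambda>z. z \<in> ball 0 1) (nhds (0::complex))"
    by (intro eventually_nhds_in_open) auto
  have f_exp: "f has_fps_expansion F"
  proof (rule has_fps_expansionI)
    show "\<forall>\<^sub>F z in nhds 0. (\<lambda>n. fps_nth F n * z ^ n) sums f z"
      using nhds
    proof eventually_elim
      case (elim z)
      then have "(\<lambda>n. fps_nth F (Suc n) * z ^ Suc n) sums f z"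
        using sums[of z] by (simp add: F_def)
      then show ?case by (subst (asm) sums_Suc_iff) (simp add: F_def)
    qed
  qed
  have g_exp: "g has_fps_expansion H"
    unfolding H_def by (rule has_fps_expansion_fps_expansion[OF _ _ g]) auto
  show "deriv f 0 = b 1"
    using fps_nth_fps_expansion[OF f_exp, of 1] by (simp add: F_def)
  have H1: "fps_nth H 1 = deriv g 0"
    using fps_nth_fps_expansion[OF g_exp, of 1] by simp
  have f0: "f 0 = 0"
    using has_fps_expansion_imp_0_eq_fps_nth_0[OF f_exp] by (simp add: F_def)
  have exp: "(\<lambda>z. f z * (\<gamma> + z * g z)) has_fps_expansion F * (fps_const \<gamma> + fps_X * H)"
    by (intro fps_expansion_intros f_exp g_exp)
  have ev: "eventually (\<lambda>z. f z * (\<gamma> + z * g z) = z) (nhds 0)"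
    using nhds
  proof eventually_elim
    case (elim z)
    show ?case
    proof (cases "z = 0")
      case False
      with elim fg[of z] have "f z \<noteq> 0" and "1 / f z = \<gamma> / z + g z" by auto
      with False have "z = f z * (z * (\<gamma> / z + g z))" by (metis nonzero_mult_div_cancel_left mult.left_commute mult.right_neutral nonzero_eq_divide_eq)
      with False show ?thesis by (simp add: algebra_simps)
    qed (simp add: f0)
  qed
  have "(\<lambda>z. z) has_fps_expansion F * (fps_const \<gamma> + fps_X * H)"
    using exp has_fps_expansion_cong[OF ev refl] by simp
  then have eq: "F * (fps_const \<gamma> + fps_X * H) = fps_X"
    using has_fps_expansion_fps_X fps_expansion_unique_complex by blast
  have e1: "b 1 * \<gamma> = 1"
    using arg_cong[OF eq, of "\<lambda>A. fps_nth A 1", unfolded fps_mult_nth]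
    by (simp add: F_def)
  have e2: "b 1 * fps_nth H 0 + b 2 * \<gamma> = 0"
    using arg_cong[OF eq, of "\<lambda>A. fps_nth A 2", unfolded fps_mult_nth]
    by (simp add: F_def eval_nat_numeral)
  have e3: "b 1 * fps_nth H 1 + b 2 * fps_nth H 0 + b 3 * \<gamma> = 0"
    using arg_cong[OF eq, of "\<lambda>A. fps_nth A 3", unfolded fps_mult_nth]
    by (simp add: F_def eval_nat_numeral)
  show "b 1 * \<gamma> = 1" by (rule e1)
  have b1: "b 1 \<noteq> 0" and \<gamma>: "\<gamma> = 1 / b 1" using e1 by (auto simp: eq_divide_eq mult.commute)
  \<comment> \<open>The second-order equation determines \<open>g 0\<close>, which is then
    eliminated from the third-order one.\<close>
  have H0: "fps_nth H 0 = - b 2 / b 1 ^ 2"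
    using e2 b1 by (simp add: \<gamma> field_simps power2_eq_square add_eq_0_iff)
  have "b 1 * fps_nth H 1 = b 2 ^ 2 / b 1 ^ 2 - b 3 / b 1"
    using e3 by (simp add: \<gamma> H0 power2_eq_square add_eq_0_iff)
  then have "fps_nth H 1 = (b 2 ^ 2 / b 1 ^ 2 - b 3 / b 1) / b 1"
    using b1 by (metis nonzero_mult_div_cancel_left)
  then show "deriv g 0 = (b 2 ^ 2 / b 1 - b 3) / b 1 ^ 2"
    unfolding H1[symmetric] by (simp add: diff_divide_distrib power2_eq_square)
qed

section \<open>Area and monotonicity inequalities for the coefficients\<close>

text \<open>The function \<open>1 / f\<close> takes only reciprocals of nonzero points of
  \<open>D\<close> on the punctured disc, so it omits the inverted exterior, and the area theorem
  applies with \<open>\<gamma> = 1 / b 1\<close>.\<close>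

lemma area_inverted_exterior_le:
  assumes f: "f holomorphic_on ball 0 1" "bij_betw f (ball 0 1) D" "f 0 = 0"
    and sums: "\<And>z. z \<in> ball 0 1 \<Longrightarrow> (\<lambda>n. b (Suc n) * z ^ Suc n) sums f z"
  shows "measure lebesgue (inverted_exterior D) \<le>
           pi * ((norm (1 / b 1))\<^sup>2 - (norm ((b 2 ^ 2 / b 1 - b 3) / b 1 ^ 2))\<^sup>2)"
proof -
  have inj: "inj_on f (ball 0 1)" and img: "f ` ball 0 1 = D"
    using f(2) by (auto simp: bij_betw_def)
  obtain \<gamma> g where g: "g holomorphic_on ball 0 1" "\<gamma> \<noteq> 0"
    and fg: "\<And>z. z \<in> ball 0 1 - {0} \<Longrightarrow> f z \<noteq> 0 \<and> 1 / f z = \<gamma> / z + g z"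
    using reciprocal_univalent_expansion[OF f(1) inj f(3)] by metis
  have coeffs: "b 1 * \<gamma> = 1" "deriv g 0 = (b 2 ^ 2 / b 1 - b 3) / b 1 ^ 2"
    using reciprocal_coefficients[OF sums g(1) fg] by blast+
  have \<gamma>: "\<gamma> = 1 / b 1"
    using coeffs(1) by (metis nonzero_mult_div_cancel_left mult_zero_left zero_neq_one)
  have inj': "inj_on (\<lambda>z. \<gamma> / z + g z) (ball 0 1 - {0})"
  proof (rule inj_onI)
    fix u v assume uv: "u \<in> ball 0 1 - {0}" "v \<in> ball 0 1 - {0}" "\<gamma> / u + g u = \<gamma> / v + g v"
    then have "f u = f v" using fg[of u] fg[of v] by (metis divide_cancel_left one_neq_zero)
    with uv show "u = v" using inj_onD[OF inj, of u v] by auto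
  qed
  have disj: "inverted_exterior D \<inter> (\<lambda>z. \<gamma> / z + g z) ` (ball 0 1 - {0}) = {}"
  proof -
    have False if z: "z \<in> ball 0 1 - {0}" and w: "\<gamma> / z + g z \<in> inverted_exterior D" for z
    proof -
      have "1 / f z \<in> inverted_exterior D" and nz: "f z \<noteq> 0" using fg[OF z] w by auto
      then obtain y where "1 / f z = 1 / y" "y \<notin> closure D"
        by (auto simp: inverted_exterior_def)
      then have "f z \<notin> closure D" using nz by (metis divide_cancel_left one_neq_zero)
      moreover have "f z \<in> D" using img z by auto
      ultimately show False using closure_subset by blast
    qed
    then show ?thesis by blast
  qed
  have "measure lebesgue (inverted_exterior D) \<le> pi * ((norm \<gamma>)\<^sup>2 - (norm (deriv g 0))\<^sup>2)"
  proof (cases "inverted_exterior D \<in> sets lebesgue")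
    case True
    then show ?thesis by (rule area_theorem[OF g(1) inj' g(2) _ disj])
  next
    \<comment> \<open>Here \<open>measure\<close> has its default value 0, and the area theorem for
      the empty set shows that the bound is nonnegative.\<close>
    case False
    then show ?thesis
      using area_theorem[OF g(1) inj' g(2), of "{}"] by (simp add: measure_notin_sets)
  qed
  then show ?thesis unfolding coeffs(2) \<gamma> .
qed

text \<open>If \<open>1 / \<omega> = \<alpha> / z + u\<close> and
  \<open>1 / h = \<beta> / z + v\<close>, then \<open>1 / f\<close> has holomorphic part
  \<open>w = \<beta> * u + v \<circ> \<omega>\<close>. Dividing \<open>Re (deriv w 0)\<close> by
  \<open>p\<close> splits off exactly the term of \<open>h\<close>, and what remains is to show
  \<open>s * Re (deriv u 0) / (p * q) \<ge> 1 / q^2 - 1 / p^2\<close>.\<close>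

lemma coefficient_functional_mono:
  fixes b c :: "nat \<Rightarrow> complex" and s :: real
  assumes f: "interior_conformal_map D f"
    and f_sums: "\<And>z. z \<in> ball 0 1 \<Longrightarrow> (\<lambda>n. b (Suc n) * z ^ Suc n) sums f z"
    and h: "interior_conformal_map V h"
    and h_sums: "\<And>z. z \<in> ball 0 1 \<Longrightarrow> (\<lambda>n. c (Suc n) * z ^ Suc n) sums h z"
    and DV: "D \<subseteq> V" and s: "\<bar>s\<bar> = 1"
    and b1: "b 1 = of_real p" "p > 0" and c1: "c 1 = of_real q" "q > 0"
  shows "1 / q\<^sup>2 + s * (Re ((c 2 ^ 2 / c 1 - c 3) / c 1 ^ 2) / q) \<le>
         1 / p\<^sup>2 + s * (Re ((b 2 ^ 2 / b 1 - b 3) / b 1 ^ 2) / p)"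
proof -
  have f': "f holomorphic_on ball 0 1" "inj_on f (ball 0 1)" "f ` ball 0 1 = D" "f 0 = 0"
    using f by (auto simp: interior_conformal_map_def bij_betw_def)
  have h': "h holomorphic_on ball 0 1" "inj_on h (ball 0 1)" "h ` ball 0 1 = V" "h 0 = 0"
    using h by (auto simp: interior_conformal_map_def bij_betw_def)
  obtain k where k: "k holomorphic_on V" "\<And>z. z \<in> ball 0 1 \<Longrightarrow> k (h z) = z"
    using holomorphic_has_inverse[OF h'(1) open_ball h'(2)] h'(3) by metis
  \<comment> \<open>With \<open>k\<close> the inverse of \<open>h\<close>, the inclusion
    \<open>D \<subseteq> V\<close> makes this a univalent self-map of the disc fixing 0.\<close>
  define \<omega> where "\<omega> = (\<lambda>z. k (f z))"
  have hol_\<omega>: "\<omega> holomorphic_on ball 0 1"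
    unfolding \<omega>_def using holomorphic_on_compose_gen[OF f'(1) k(1)] f'(3) DV by (simp add: o_def image_subset_iff_funcset[symmetric])
  have \<omega>: "\<omega> z \<in> ball 0 1" "h (\<omega> z) = f z" if "z \<in> ball 0 1" for z
  proof -
    have "f z \<in> h ` ball 0 1" using that f'(3) h'(3) DV by auto
    then obtain y where "y \<in> ball 0 1" "f z = h y" by auto
    then show "\<omega> z \<in> ball 0 1" "h (\<omega> z) = f z" using k(2) by (auto simp: \<omega>_def)
  qed
  have inj_\<omega>: "inj_on \<omega> (ball 0 1)"
    by (rule inj_onI) (metis \<omega>(2) f'(2) inj_onD)
  have \<omega>0: "\<omega> 0 = 0" using k(2)[of 0] by (simp add: \<omega>_def f'(4) h'(4))
  obtain \<alpha> u where u: "u holomorphic_on ball 0 1" "\<alpha> \<noteq> 0"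
    and \<omega>u: "\<And>z. z \<in> ball 0 1 - {0} \<Longrightarrow> \<omega> z \<noteq> 0 \<and> 1 / \<omega> z = \<alpha> / z + u z"
    using reciprocal_univalent_expansion[OF hol_\<omega> inj_\<omega> \<omega>0] by metis
  obtain \<beta> v where v: "v holomorphic_on ball 0 1" "\<beta> \<noteq> 0"
    and hv: "\<And>z. z \<in> ball 0 1 - {0} \<Longrightarrow> h z \<noteq> 0 \<and> 1 / h z = \<beta> / z + v z"
    using reciprocal_univalent_expansion[OF h'(1,2,4)] by metis
  have h_coeffs: "deriv h 0 = c 1" "c 1 * \<beta> = 1" "deriv v 0 = (c 2 ^ 2 / c 1 - c 3) / c 1 ^ 2"
    using reciprocal_coefficients[OF h_sums v(1) hv] by blast+
  \<comment> \<open>The holomorphic part of \<open>1 / f = 1 / (h \<circ> \<omega>)\<close>.\<close>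
  define w where "w = (\<lambda>z. \<beta> * u z + v (\<omega> z))"
  have hol_v\<omega>: "(\<lambda>z. v (\<omega> z)) holomorphic_on ball 0 1"
    using holomorphic_on_compose_gen[OF hol_\<omega> v(1)] \<omega>(1) by (simp add: o_def image_subset_iff)
  have hol_w: "w holomorphic_on ball 0 1"
    unfolding w_def by (intro holomorphic_intros u hol_v\<omega>)
  have fw: "f z \<noteq> 0 \<and> 1 / f z = \<beta> * \<alpha> / z + w z" if z: "z \<in> ball 0 1 - {0}" for z
  proof -
    have "\<omega> z \<in> ball 0 1 - {0}" "h (\<omega> z) = f z" using \<omega>[of z] \<omega>u[OF z] z by auto
    with hv[of "\<omega> z"] have "f z \<noteq> 0" "1 / f z = \<beta> * (1 / \<omega> z) + v (\<omega> z)" by auto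
    with \<omega>u[OF z] show ?thesis by (simp add: w_def algebra_simps)
  qed
  have f_coeffs: "deriv f 0 = b 1" "b 1 * (\<beta> * \<alpha>) = 1" "deriv w 0 = (b 2 ^ 2 / b 1 - b 3) / b 1 ^ 2"
    using reciprocal_coefficients[OF f_sums hol_w fw] by blast+
  have diff: "f field_differentiable at z" if "f holomorphic_on ball 0 1" "z \<in> ball 0 1" for f :: "complex \<Rightarrow> complex" and z
    using that holomorphic_on_imp_differentiable_at open_ball by blast
  have deriv_comp: "deriv (\<lambda>z. F (\<omega> z)) 0 = deriv F 0 * deriv \<omega> 0" if "F holomorphic_on ball 0 1" for F
    using deriv_chain[of \<omega> 0 F] diff[OF hol_\<omega>, of 0] diff[OF that, of 0] by (simp add: o_def \<omega>0)
  have "deriv f 0 = deriv (\<lambda>z. h (\<omega> z)) 0"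
    by (rule complex_derivative_transform_within_open[OF f'(1) _ open_ball])
       (use holomorphic_on_compose_gen[OF hol_\<omega> h'(1)] \<omega> in \<open>auto simp: o_def image_subset_iff\<close>)
  then have \<omega>': "deriv \<omega> 0 = of_real (p / q)"
    using deriv_comp[OF h'(1)] f_coeffs(1) h_coeffs(1) b1 c1 by (simp add: field_simps)
  have \<beta>: "\<beta> = of_real (1 / q)" using h_coeffs(2) c1 by (simp add: field_simps)
  have \<alpha>: "\<alpha> = of_real (q / p)"
    using f_coeffs(2) b1 c1 by (simp add: \<beta> field_simps)
  have "deriv w 0 = \<beta> * deriv u 0 + deriv v 0 * deriv \<omega> 0"
  proof -
    have "deriv w 0 = deriv (\<lambda>z. \<beta> * u z) 0 + deriv (\<lambda>z. v (\<omega> z)) 0"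
      unfolding w_def using diff[OF u(1), of 0] diff[OF hol_v\<omega>, of 0]
      by (intro deriv_add field_differentiable_mult) auto
    also have "deriv (\<lambda>z. \<beta> * u z) 0 = \<beta> * deriv u 0"
      using diff[OF u(1), of 0] by (intro deriv_cmult) auto
    finally show ?thesis using deriv_comp[OF v(1)] by simp
  qed
  then have Re_w: "Re (deriv w 0) = Re (deriv u 0) / q + Re (deriv v 0) * (p / q)"
    unfolding \<beta> \<omega>' by simp
  \<comment> \<open>The holomorphic part of \<open>1 / \<omega> - s * \<omega>\<close>, which is
    univalent as a composition of \<open>\<omega>\<close> with a Joukowski map. The sign
    \<open>- s\<close> is the one for which the coefficient bound estimates
    \<open>s * Re (deriv u 0)\<close> from below.\<close>
  define y where "y = (\<lambda>z. u z + of_real (- s) * \<omega> z)"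
  have hol_y: "y holomorphic_on ball 0 1"
    unfolding y_def by (intro holomorphic_intros u hol_\<omega>)
  have "inj_on (\<lambda>z. \<alpha> / z + y z) (ball 0 1 - {0})"
  proof -
    have "inj_on (\<lambda>x. 1 / x + of_real (- s) * x) (\<omega> ` (ball 0 1 - {0}))"
      by (rule inj_on_subset[OF inj_on_Joukowski]) (use s \<omega> \<omega>u in auto)
    then have "inj_on ((\<lambda>x. 1 / x + of_real (- s) * x) \<circ> \<omega>) (ball 0 1 - {0})"
      by (intro comp_inj_on inj_on_subset[OF inj_\<omega>]) auto
    moreover have "((\<lambda>x. 1 / x + of_real (- s) * x) \<circ> \<omega>) z = \<alpha> / z + y z"
      if "z \<in> ball 0 1 - {0}" for z using \<omega>u[OF that] by (simp add: y_def)
    ultimately show ?thesis by (subst (asm) inj_on_cong) auto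
  qed
  then have "norm (deriv y 0) \<le> q / p"
    using univalent_pole_coefficient_bound[OF hol_y _ u(2)] b1 c1 by (simp add: \<alpha> norm_divide)
  moreover have "deriv y 0 = deriv u 0 + of_real (- s) * of_real (p / q)"
  proof -
    have "deriv y 0 = deriv u 0 + deriv (\<lambda>z. of_real (- s) * \<omega> z) 0"
      unfolding y_def using diff[OF u(1), of 0] diff[OF hol_\<omega>, of 0]
      by (intro deriv_add field_differentiable_mult) auto
    also have "deriv (\<lambda>z. of_real (- s) * \<omega> z) 0 = of_real (- s) * deriv \<omega> 0"
      using diff[OF hol_\<omega>, of 0] by (intro deriv_cmult) auto
    finally show ?thesis by (simp only: \<omega>')
  qed
  ultimately have "\<bar>Re (deriv u 0) - s * (p / q)\<bar> \<le> q / p"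
    using order_trans[OF abs_Re_le_cmod, of "deriv y 0"] by simp
  then have "s * Re (deriv u 0) \<ge> p / q - q / p"
    using s by (cases "s = 1") (auto simp: abs_if split: if_splits)
  then have "(p / q - q / p) / (p * q) \<le> s * Re (deriv u 0) / (p * q)"
    using b1 c1 by (intro divide_right_mono) auto
  moreover have "(p / q - q / p) / (p * q) = 1 / q\<^sup>2 - 1 / p\<^sup>2"
    using b1 c1 by (simp add: field_simps power2_eq_square)
  moreover have "s * (Re (deriv w 0) / p) = s * Re (deriv u 0) / (p * q) + s * (Re (deriv v 0) / q)"
    unfolding Re_w using b1 c1 by (simp add: field_simps)
  ultimately show ?thesis
    unfolding f_coeffs(3)[symmetric] h_coeffs(3)[symmetric] by linarith
qed

theorem theorem5p3:
  fixes Dt :: "complex set" and \<Phi> :: "complex \<Rightarrow> complex" and b :: "nat \<Rightarrow> complex"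
    and \<Omega> :: "complex set"
  assumes "enclosed_by_smooth_Jordan_curve Dt" and "0 \<in> Dt"
    and "interior_conformal_map Dt \<Phi>"
    and "\<And>z. z \<in> ball 0 1 \<Longrightarrow> (\<lambda>n. b (Suc n) * z ^ Suc n) sums \<Phi> z"
    and "\<Omega> = inverted_exterior Dt"
  shows
    "(\<forall>s\<in>{1, -1::real}.
        1 / Re (b 1) ^ 2 + s * (1 / Re (b 1) ^ 3 * Re (b 2 ^ 2 / b 1 - b 3))
          \<ge> measure lebesgue \<Omega> / (2 * pi)) \<and>
     (measure lebesgue \<Omega> = 1 \<longrightarrow>
       (\<forall>s\<in>{1, -1::real}.
          1 / Re (b 1) ^ 2 + s * (1 / Re (b 1) ^ 3 * Re (b 2 ^ 2 / b 1 - b 3))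
            \<ge> 1 / (2 * pi))) \<and>
     (\<forall>(Vt :: complex set) (\<Psi> :: complex \<Rightarrow> complex) (c :: nat \<Rightarrow> complex).
        enclosed_by_smooth_Jordan_curve Vt \<and> Dt \<subseteq> Vt \<and>
        interior_conformal_map Vt \<Psi> \<and>
        (\<forall>z\<in>ball 0 1. (\<lambda>n. c (Suc n) * z ^ Suc n) sums \<Psi> z) \<longrightarrow>
        (\<forall>s\<in>{1, -1::real}.
           1 / Re (b 1) ^ 2 + s * (1 / Re (b 1) ^ 3 * Re (b 2 ^ 2 / b 1 - b 3))
             \<ge> 1 / Re (c 1) ^ 2 + s * (1 / Re (c 1) ^ 3 * Re (c 2 ^ 2 / c 1 - c 3))))"
proof -
  have b1: "b 1 = of_real (Re (b 1))" "Re (b 1) > 0"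
    if "interior_conformal_map D f" "\<And>z. z \<in> ball 0 1 \<Longrightarrow> (\<lambda>n. b (Suc n) * z ^ Suc n) sums f z"
    for D f and b :: "nat \<Rightarrow> complex"
  proof -
    have f: "f holomorphic_on ball 0 1" "inj_on f (ball 0 1)" "f 0 = 0"
      and d: "deriv f 0 \<in> \<real>" "Re (deriv f 0) > 0"
      using that(1) by (auto simp: interior_conformal_map_def bij_betw_def)
    obtain \<gamma> g where g: "g holomorphic_on ball 0 1"
        "\<And>z. z \<in> ball 0 1 - {0} \<Longrightarrow> f z \<noteq> 0 \<and> 1 / f z = \<gamma> / z + g z"
      using reciprocal_univalent_expansion[OF f] by metis
    have "deriv f 0 = b 1" by (rule reciprocal_coefficients(1)[OF that(2) g])
    with d show "b 1 = of_real (Re (b 1))" "Re (b 1) > 0" by simp_all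
  qed
  \<comment> \<open>As \<open>b 1\<close> is real, division by \<open>b 1 ^ 2\<close> commutes with
    \<open>Re\<close>; this is the normalization in which the functional appears in the
    lemmas.\<close>
  have rewrite: "1 / Re (b 1) ^ 3 * Re (b 2 ^ 2 / b 1 - b 3) = Re ((b 2 ^ 2 / b 1 - b 3) / b 1 ^ 2) / Re (b 1)"
    if "b 1 = of_real (Re (b 1))" for b :: "nat \<Rightarrow> complex"
  proof -
    have "Re (x / b 1 ^ 2) = Re x / Re (b 1) ^ 2" for x
      by (subst that) (metis Re_divide_of_real of_real_power)
    then show ?thesis by (simp add: power2_eq_square power3_eq_cube)
  qed
  define p where "p = Re (b 1)"
  define A where "A = (b 2 ^ 2 / b 1 - b 3) / b 1 ^ 2"
  have p: "b 1 = of_real p" "p > 0"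
    using b1[OF assms(3,4)] by (auto simp: p_def)
  have eq: "1 / Re (b 1) ^ 3 * Re (b 2 ^ 2 / b 1 - b 3) = Re A / p"
    using rewrite[of b] p by (simp add: A_def)
  have area: "measure lebesgue \<Omega> \<le> pi * (1 / p\<^sup>2 - (norm A)\<^sup>2)"
    using area_inverted_exterior_le[of \<Phi> Dt b] assms(3-5) p
    by (simp add: interior_conformal_map_def A_def norm_divide power_divide)
  have part1: "measure lebesgue \<Omega> / (2 * pi) \<le> 1 / p\<^sup>2 + s * (Re A / p)" if s: "s \<in> {1, -1}" for s :: real
  proof -
    \<comment> \<open>Half the square below equals \<open>1 / p^2 + s * (Re A / p)\<close> minus
      \<open>(1 / p^2 - (Re A)^2) / 2\<close>, and the subtracted term is at least half the bound
      for the area divided by \<open>pi\<close>.\<close>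
    have "(Re A)\<^sup>2 \<le> (norm A)\<^sup>2" by (simp add: cmod_power2)
    moreover have "0 \<le> (1 / p + s * Re A)\<^sup>2" by simp
    moreover have "(1 / p + s * Re A)\<^sup>2 = 1 / p\<^sup>2 + (Re A)\<^sup>2 + 2 * (s * (Re A / p))"
      using s by (auto simp: power2_eq_square algebra_simps)
    ultimately have "(1 / p\<^sup>2 - (norm A)\<^sup>2) / 2 \<le> 1 / p\<^sup>2 + s * (Re A / p)" by argo
    moreover have "measure lebesgue \<Omega> / (2 * pi) \<le> (1 / p\<^sup>2 - (norm A)\<^sup>2) / 2"
      using area by (simp add: field_simps)
    ultimately show ?thesis by linarith
  qed
  have part2: "1 / p\<^sup>2 + s * (Re A / p) \<ge> 1 / Re (c 1) ^ 2 + s * (1 / Re (c 1) ^ 3 * Re (c 2 ^ 2 / c 1 - c 3))"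
    if V: "Dt \<subseteq> Vt" "interior_conformal_map Vt \<Psi>"
      "\<forall>z\<in>ball 0 1. (\<lambda>n. c (Suc n) * z ^ Suc n) sums \<Psi> z" and s: "s \<in> {1, -1}"
    for Vt \<Psi> and c :: "nat \<Rightarrow> complex" and s :: real
  proof -
    have c: "c 1 = of_real (Re (c 1))" "Re (c 1) > 0"
      using b1[OF V(2), of c] V(3) by auto
    show ?thesis
      unfolding A_def rewrite[of c, OF c(1)]
      by (rule coefficient_functional_mono[where f = \<Phi> and h = \<Psi> and b = b and c = c, OF assms(3,4) V(2) _ V(1) _ p c])
         (use V(3) s in auto)
  qed
  show ?thesis
    unfolding eq unfolding p_def[symmetric]
  proof (intro conjI ballI impI allI)
    show "1 / (2 * pi) \<le> 1 / p\<^sup>2 + s * (Re A / p)" if "measure lebesgue \<Omega> = 1" "s \<in> {1, -1}" for s :: real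
      using part1[OF that(2)] that(1) by simp
  qed (use part1 part2 in blast)+
qed

end
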